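(* Let $\alpha\in(0,1)$, fix $\gamma\in\Gamma$, and suppose that Assumption B (stated in the context) holds for every $h\in\mathcal{H}$. Let $$\lambda=\left\{E_X[f(g(X,\theta_0)|X,\theta_0,\gamma)\nabla_\theta g(X,\theta_0)]\right\}^{-1},\qquad \bar h^+=\lambda\log\left(1/(1-\alpha)\right),$$ and suppose $\bar h^+\in\mathcal{H}$. Let $\{\hat h_n^+\}$ be a random sequence such that $\sqrt n(\hat h_n^+-\bar h^+)=O_{P_{\theta_0+h/n,\gamma}}(1)$ for every fixed $h\in\mathcal{H}$. Define the test $$\phi_n^+(\hat h_n^+,Y^n,X^n)=\begin{cases}1&\text{if } Y_i<\max\{g(X_i,\theta_0),g(X_i,\theta_0+\hat h_n^+/n)\}\text{ for some } i,\\ 0&\text{if } Y_i\ge\max\{g(X_i,\theta_0),g(X_i,\theta_0+\hat h_n^+/n)\}\text{ for all } i.\end{cases}$$ Then $\{\phi_n^+(\hat h_n^+,Y^n,X^n)\}$ is asymptotically uniformly most powerful (AUMP) in $\mathcal{H}$ at asymptotic level $\alpha$ for the nuisance parameter value $\gamma$ when testing $H_0^+:h\ge0$ against $H_1^+:h<0$. That is, $\limsup_nE_{\theta_0+h/n,\gamma}[\phi_n^+]\le\alpha$ for every $h\ge0$ in $\mathcal{H}$, and for every other sequence of tests $\{\psi_n\}$ satisfying $\limsup_nE_{\theta_0+h/n,\gamma}[\psi_n]\le\alpha$ for every $h\ge0$ in $\mathcal{H}$, $$\liminf_nE_{\theta_0+h/n,\gamma}[\phi_n^+]\ \ge\ \limsup_nE_{\theta_0+h/n,\gamma}[\psi_n]\quad\text{for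 every } h<0\text{ in }\mathcal{H}.$$
   Context: Model. $(Y,X)$ with $Y$ scalar and $X$ a $d_X$-dimensional vector of discrete covariates with finite support $\mathcal{X}=\{a_1,\ldots,a_L\}$. Conditionally on $X=x$, $Y$ has Lebesgue density $f(y|x,\theta,\gamma)\mathbb{I}\{y\ge g(x,\theta)\}$, where $\theta\in\Theta\subset\mathbb{R}$ is the scalar parameter of interest, $\gamma\in\Gamma\subset\mathbb{R}^d$ is a nuisance parameter, and $\mathbb{I}\{\cdot\}$ is the indicator function. Fix $\theta_0\in\Theta$ and reparametrize $h=n(\theta-\theta_0)\in\mathcal{H}\subset\mathbb{R}$. One observes an i.i.d. sample $(Y^n,X^n)=((Y_1,\ldots,Y_n),(X_1,\ldots,X_n))$. $P_{\theta_0+h/n,\gamma}$ and $E_{\theta_0+h/n,\gamma}$ denote probability and expectation when the sample is drawn from the model with parameters $(\theta_0+h/n,\gamma)$ ($n$ large enough that $\theta_0+h/n\in\Theta$); $E_X$ is expectation over the marginal law of $X$. $O_{P_{\theta_0+h/n,\gamma}}(1)$ means bounded in probability under the sequence $P_{\theta_0+h/n,\gamma}$. A test is a $[0,1]$-valued measurable function of the data, interpreted as the probability of rejecting the null. Expressions such as $g(X_i,\theta_0+\hat h_n/n)$ may be defined arbitrarily on the event (of probability tending to zero) where the plugged-in parameter leaves the parameter space. Assumption B. (i) $\{(Y_i,X_i)\}_{i=1}^n$ is an i.i.d. sample taking values in $\mathcal{Y}\times\mathcal{X}$, $\mathcal{Y}\subset\mathbb{R}$, with $\mathcal{X}=\{a_1,\ldots,a_L\}$,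 and the conditional density of $Y$ given $X=x$ is $f(y|x,\theta,\gamma)\mathbb{I}\{y\ge g(x,\theta)\}$. $\Theta\times\Gamma$ is convex, $\theta_0\in\mathrm{int}(\Theta)$, $\gamma\in\mathrm{int}(\Gamma)$, $0\in\mathcal{H}$. The marginal distribution of $X$ satisfies $\Pr\{X=a_j\}>0$ for each $j=1,\ldots,L$ and does not depend on $(\theta,\gamma)$. (ii) $\{\hat h_n\}$ is a random sequence satisfying $\sqrt n(\hat h_n-\bar h)=O_{P_{\theta_0+h/n,\gamma}}(1)$ for some user-specified constant $\bar h$ (in the claim, $\hat h_n=\hat h_n^+$ and $\bar h=\bar h^+$), and $\{\hat\gamma_n\}$ is a random sequence satisfying $\sqrt n(\hat\gamma_n-\gamma)=O_{P_{\theta_0+h/n,\gamma}}(1)$. (iii) Let $\beta=(\theta,\gamma')'$ and let $\beta_0=(\theta_0,\gamma')'$ with $\gamma$ the fixed true value. $f(y|x,\beta)$ is twice continuously differentiable in $\beta$ for all $y,x$, and $g(x,\theta)$ is continuously differentiable in $\theta$ for all $x$. In some open neighborhood $\mathcal{N}$ of $\beta_0$: $f(y|x,\beta)$ and $\nabla_\beta f(y|x,\beta)$ are continuous in $y$ for $\beta\in\mathcal{N}$; there is a constant $C$ such that $0<f(y|x,\beta)<C<\infty$ and $\|\nabla_\beta f(y|x,\beta)\|<C<\infty$ for all $y,x$ and $\beta\in\mathcal{N}$; and for each $j=1,\ldots,L$, $$\int\sup_{\beta\in\mathcal{N}}\|\nabla_\beta f(y|a_j,\beta)\|\,\mathbb{I}\{y\ge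 g(a_j,\theta)\}\,dy<\infty,$$ $$\int\sup_{\bar\beta,\beta\in\mathcal{N}}\frac{\|\nabla_\beta f(y|a_j,\bar\beta)\|^2}{f(y|a_j,\bar\beta)^2}\mathbb{I}\{y\ge g(a_j,\theta)\}f(y|a_j,\beta)\,dy<\infty,$$ $$\int\sup_{\bar\beta,\beta\in\mathcal{N}}\frac{\|\nabla_{\beta\beta} f(y|a_j,\bar\beta)\|}{f(y|a_j,\bar\beta)}\mathbb{I}\{y\ge g(a_j,\theta)\}f(y|a_j,\beta)\,dy<\infty.$$ $\nabla_\theta g(a_j,\theta_0)>0$ and $\sup_{\beta\in\mathcal{N}}\|\nabla_\theta g(a_j,\theta)\|<\infty$ for each $j=1,\ldots,L$. *)

theory Defs
  imports "HOL-Probability.Probability"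
begin

text \<open>
  Conventions. The law of the covariate \<open>X\<close> is a pmf \<open>pX\<close>; its support \<open>set_pmf pX\<close> is the set
  \<open>{a\<^sub>1, \<dots>, a\<^sub>L}\<close>, so each support point has positive probability by construction.
  The parameter is \<open>\<beta> = (\<theta>, \<gamma>)\<close>, an element of \<open>real \<times> (real^'d)\<close> with its Euclidean norm.
  \<open>f y x \<beta>\<close> is \<open>f(y|x,\<beta>)\<close> and \<open>g x \<theta>\<close> is \<open>g(x,\<theta>)\<close>; \<open>f\<close> is only meant for \<open>y \<in> \<Y>\<close>,
  \<open>x \<in> set_pmf pX\<close>, \<open>\<beta> \<in> \<Theta> \<times> \<Gamma>\<close>, and \<open>g\<close> only for \<open>x \<in> set_pmf pX\<close>, \<open>\<theta> \<in> \<Theta>\<close>. The values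
  elsewhere are junk and no assumption is made about them.
\<close>

definition lebesgue_on_Y :: "real set \<Rightarrow> real measure" where
  "lebesgue_on_Y \<Y> = restrict_space lborel \<Y>"

text \<open>The dominating measure on \<open>\<Y> \<times> {a\<^sub>1, \<dots>, a\<^sub>L}\<close>: Lebesgue measure times counting measure.\<close>

definition dom_measure :: "real set \<Rightarrow> (real^'dx) pmf \<Rightarrow> (real \<times> (real^'dx)) measure" where
  "dom_measure \<Y> pX = lebesgue_on_Y \<Y> \<Otimes>\<^sub>M count_space (set_pmf pX)"

definition cond_density ::
  "(real \<Rightarrow> real^'dx \<Rightarrow> real \<times> (real^'d) \<Rightarrow> real) \<Rightarrow> (real^'dx \<Rightarrow> real \<Rightarrow> real)
    \<Rightarrow> real \<times> (real^'d) \<Rightarrow> real^'dx \<Rightarrow> real \<Rightarrow> real" where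
  "cond_density f g \<beta> x y = f y x \<beta> * indicator {g x (fst \<beta>)..} y"

definition obs_law ::
  "real set \<Rightarrow> (real^'dx) pmf \<Rightarrow> (real \<Rightarrow> real^'dx \<Rightarrow> real \<times> (real^'d) \<Rightarrow> real)
    \<Rightarrow> (real^'dx \<Rightarrow> real \<Rightarrow> real) \<Rightarrow> real \<times> (real^'d) \<Rightarrow> (real \<times> (real^'dx)) measure" where
  "obs_law \<Y> pX f g \<beta> =
     density (dom_measure \<Y> pX) (\<lambda>(y, x). ennreal (pmf pX x * cond_density f g \<beta> x y))"

text \<open>
  The sample \<open>\<omega>\<close> lists the observations \<open>(Y, X)\<close> with indices \<open>0, \<dots>, n - 1\<close>. Only the
  \<open>\<sigma>\<close>-algebra of \<open>sample_space\<close> matters.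
\<close>

definition sample_space ::
  "real set \<Rightarrow> (real^'dx) pmf \<Rightarrow> nat \<Rightarrow> (nat \<Rightarrow> real \<times> (real^'dx)) measure" where
  "sample_space \<Y> pX n = PiM {..<n} (\<lambda>_. dom_measure \<Y> pX)"

definition sample_law ::
  "real set \<Rightarrow> (real^'dx) pmf \<Rightarrow> (real \<Rightarrow> real^'dx \<Rightarrow> real \<times> (real^'d) \<Rightarrow> real)
    \<Rightarrow> (real^'dx \<Rightarrow> real \<Rightarrow> real) \<Rightarrow> real \<times> (real^'d) \<Rightarrow> nat
    \<Rightarrow> (nat \<Rightarrow> real \<times> (real^'dx)) measure" where
  "sample_law \<Y> pX f g \<beta> n = PiM {..<n} (\<lambda>_. obs_law \<Y> pX f g \<beta>)"

text \<open>
  \<open>P\<^bsub>\<theta>0 + h/n, \<gamma>\<^esub>\<close>. It is a probability measure once \<open>\<theta>0 + h/n \<in> \<Theta>\<close>; the finitely many smaller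
  \<open>n\<close> do not affect any of the asymptotic notions below.
\<close>

definition local_law ::
  "real set \<Rightarrow> (real^'dx) pmf \<Rightarrow> (real \<Rightarrow> real^'dx \<Rightarrow> real \<times> (real^'d) \<Rightarrow> real)
    \<Rightarrow> (real^'dx \<Rightarrow> real \<Rightarrow> real) \<Rightarrow> real \<Rightarrow> real^'d \<Rightarrow> real \<Rightarrow> nat
    \<Rightarrow> (nat \<Rightarrow> real \<times> (real^'dx)) measure" where
  "local_law \<Y> pX f g \<theta>0 \<gamma> h n = sample_law \<Y> pX f g (\<theta>0 + h / real n, \<gamma>) n"

definition bounded_in_prob ::
  "(nat \<Rightarrow> 'o measure) \<Rightarrow> (nat \<Rightarrow> 'o \<Rightarrow> 'b::real_normed_vector) \<Rightarrow> bool" where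
  "bounded_in_prob P Z \<longleftrightarrow>
     (\<forall>\<epsilon>>0. \<exists>M. \<forall>\<^sub>F n in sequentially. measure (P n) {\<omega> \<in> space (P n). norm (Z n \<omega>) > M} < \<epsilon>)"

definition sqrt_n_consistent ::
  "(nat \<Rightarrow> 'o measure) \<Rightarrow> (nat \<Rightarrow> 'o measure) \<Rightarrow> (nat \<Rightarrow> 'o \<Rightarrow> 'b::euclidean_space) \<Rightarrow> 'b \<Rightarrow> bool" where
  "sqrt_n_consistent S P T t \<longleftrightarrow>
     (\<forall>n. T n \<in> borel_measurable (S n)) \<and>
     bounded_in_prob P (\<lambda>n \<omega>. sqrt (real n) *\<^sub>R (T n \<omega> - t))"

text \<open>
  \<open>F\<close> is twice continuously differentiable on \<open>S\<close> with gradient \<open>DF\<close> and Hessian \<open>D2F\<close>. At boundary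
  points of \<open>S\<close> the derivatives are taken within \<open>S\<close>; for convex \<open>S\<close> with nonempty interior they are
  unique on all of \<open>S\<close>.
\<close>

definition twice_cont_diff ::
  "'b::euclidean_space set \<Rightarrow> ('b \<Rightarrow> real) \<Rightarrow> ('b \<Rightarrow> 'b) \<Rightarrow> ('b \<Rightarrow> ('b \<Rightarrow>\<^sub>L 'b)) \<Rightarrow> bool" where
  "twice_cont_diff S F DF D2F \<longleftrightarrow>
     (\<forall>\<beta>\<in>S. (F has_derivative (\<lambda>v. DF \<beta> \<bullet> v)) (at \<beta> within S)) \<and>
     (\<forall>\<beta>\<in>S. (DF has_derivative blinfun_apply (D2F \<beta>)) (at \<beta> within S)) \<and>
     continuous_on S D2F"

definition cont_diff :: "real set \<Rightarrow> (real \<Rightarrow> real) \<Rightarrow> bool" where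
  "cont_diff S F \<longleftrightarrow>
     (\<exists>DF. (\<forall>\<theta>\<in>S. (F has_real_derivative DF \<theta>) (at \<theta> within S)) \<and> continuous_on S DF)"

text \<open>
  The condition \<open>g x \<theta>0 \<in> interior \<Y>\<close> is vacuous for \<open>\<Y> = UNIV\<close>; it says that
  \<open>\<Y>\<close> contains the boundary point at which \<open>f\<close> is evaluated, together with nearby points.
\<close>

definition assumption_B_model ::
  "real set \<Rightarrow> (real^'dx) pmf \<Rightarrow> (real \<Rightarrow> real^'dx \<Rightarrow> real \<times> (real^'d) \<Rightarrow> real)
    \<Rightarrow> (real^'dx \<Rightarrow> real \<Rightarrow> real) \<Rightarrow> real set \<Rightarrow> (real^'d) set \<Rightarrow> real set \<Rightarrow> real \<Rightarrow> real^'d \<Rightarrow> bool" where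
  "assumption_B_model \<Y> pX f g \<Theta> \<Gamma> \<H> \<theta>0 \<gamma> \<longleftrightarrow>
     \<Y> \<in> sets borel \<and>
     finite (set_pmf pX) \<and>
     (\<forall>x\<in>set_pmf pX. g x \<theta>0 \<in> interior \<Y>) \<and>
     (\<forall>x\<in>set_pmf pX. \<forall>\<beta>\<in>\<Theta> \<times> \<Gamma>.
        cond_density f g \<beta> x \<in> borel_measurable (lebesgue_on_Y \<Y>) \<and>
        (\<forall>y\<in>\<Y>. 0 \<le> cond_density f g \<beta> x y) \<and>
        (\<integral>\<^sup>+ y. ennreal (cond_density f g \<beta> x y) \<partial>lebesgue_on_Y \<Y>) = 1) \<and>
     convex (\<Theta> \<times> \<Gamma>) \<and> \<theta>0 \<in> interior \<Theta> \<and> \<gamma> \<in> interior \<Gamma> \<and> 0 \<in> \<H>"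

text \<open>Suprema of integrands are taken in \<open>ennreal\<close>, so they always exist.\<close>

definition assumption_B_regularity ::
  "real set \<Rightarrow> (real^'dx) pmf \<Rightarrow> (real \<Rightarrow> real^'dx \<Rightarrow> real \<times> (real^'d) \<Rightarrow> real)
    \<Rightarrow> (real^'dx \<Rightarrow> real \<Rightarrow> real) \<Rightarrow> real set \<Rightarrow> (real^'d) set \<Rightarrow> real \<Rightarrow> real^'d \<Rightarrow> bool" where
  "assumption_B_regularity \<Y> pX f g \<Theta> \<Gamma> \<theta>0 \<gamma> \<longleftrightarrow>
     (\<exists>Df D2f.
        (\<forall>y\<in>\<Y>. \<forall>x\<in>set_pmf pX. twice_cont_diff (\<Theta> \<times> \<Gamma>) (f y x) (Df y x) (D2f y x)) \<and>
        (\<forall>x\<in>set_pmf pX. cont_diff \<Theta> (g x)) \<and>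
        (\<exists>\<N>. open \<N> \<and> (\<theta>0, \<gamma>) \<in> \<N> \<and> \<N> \<subseteq> \<Theta> \<times> \<Gamma> \<and>
           (\<forall>x\<in>set_pmf pX. \<forall>\<beta>\<in>\<N>.
              continuous_on \<Y> (\<lambda>y. f y x \<beta>) \<and> continuous_on \<Y> (\<lambda>y. Df y x \<beta>)) \<and>
           (\<exists>C. \<forall>y\<in>\<Y>. \<forall>x\<in>set_pmf pX. \<forall>\<beta>\<in>\<N>.
              0 < f y x \<beta> \<and> f y x \<beta> < C \<and> norm (Df y x \<beta>) < C) \<and>
           (\<forall>x\<in>set_pmf pX.
              (\<integral>\<^sup>+ y. (SUP \<beta>\<in>\<N>. ennreal (norm (Df y x \<beta>) * indicator {g x (fst \<beta>)..} y))
                 \<partial>lebesgue_on_Y \<Y>) < \<infinity> \<and>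
              (\<integral>\<^sup>+ y. (SUP (\<beta>', \<beta>)\<in>\<N> \<times> \<N>.
                   ennreal ((norm (Df y x \<beta>'))\<^sup>2 / (f y x \<beta>')\<^sup>2
                     * indicator {g x (fst \<beta>)..} y * f y x \<beta>))
                 \<partial>lebesgue_on_Y \<Y>) < \<infinity> \<and>
              (\<integral>\<^sup>+ y. (SUP (\<beta>', \<beta>)\<in>\<N> \<times> \<N>.
                   ennreal (norm (D2f y x \<beta>') / f y x \<beta>'
                     * indicator {g x (fst \<beta>)..} y * f y x \<beta>))
                 \<partial>lebesgue_on_Y \<Y>) < \<infinity>) \<and>
           (\<forall>x\<in>set_pmf pX.
              deriv (g x) \<theta>0 > 0 \<and> bdd_above ((\<lambda>\<beta>. \<bar>deriv (g x) (fst \<beta>)\<bar>) ` \<N>))))"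

definition assumption_B ::
  "real set \<Rightarrow> (real^'dx) pmf \<Rightarrow> (real \<Rightarrow> real^'dx \<Rightarrow> real \<times> (real^'d) \<Rightarrow> real)
    \<Rightarrow> (real^'dx \<Rightarrow> real \<Rightarrow> real) \<Rightarrow> real set \<Rightarrow> (real^'d) set \<Rightarrow> real set \<Rightarrow> real \<Rightarrow> real^'d
    \<Rightarrow> (nat \<Rightarrow> (nat \<Rightarrow> real \<times> (real^'dx)) \<Rightarrow> real) \<Rightarrow> real
    \<Rightarrow> (nat \<Rightarrow> (nat \<Rightarrow> real \<times> (real^'dx)) \<Rightarrow> real^'d) \<Rightarrow> real \<Rightarrow> bool" where
  "assumption_B \<Y> pX f g \<Theta> \<Gamma> \<H> \<theta>0 \<gamma> hhat hbar \<gamma>hat h \<longleftrightarrow>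
     assumption_B_model \<Y> pX f g \<Theta> \<Gamma> \<H> \<theta>0 \<gamma> \<and>
     sqrt_n_consistent (sample_space \<Y> pX) (local_law \<Y> pX f g \<theta>0 \<gamma> h) hhat hbar \<and>
     sqrt_n_consistent (sample_space \<Y> pX) (local_law \<Y> pX f g \<theta>0 \<gamma> h) \<gamma>hat \<gamma> \<and>
     assumption_B_regularity \<Y> pX f g \<Theta> \<Gamma> \<theta>0 \<gamma>"

text \<open>
  \<open>g(X\<^sub>i, \<theta>0 + h/n)\<close>, replaced by an arbitrary value \<open>junk\<close> when \<open>\<theta>0 + h/n\<close> leaves the parameter
  space.
\<close>

definition plug_in_boundary ::
  "(real^'dx \<Rightarrow> real \<Rightarrow> real) \<Rightarrow> real set \<Rightarrow> real \<Rightarrow> real \<Rightarrow> nat \<Rightarrow> real^'dx \<Rightarrow> real \<Rightarrow> real" where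
  "plug_in_boundary g \<Theta> \<theta>0 junk n x h =
     (if \<theta>0 + h / real n \<in> \<Theta> then g x (\<theta>0 + h / real n) else junk)"

definition phi_plus ::
  "(real^'dx \<Rightarrow> real \<Rightarrow> real) \<Rightarrow> real set \<Rightarrow> real
    \<Rightarrow> (nat \<Rightarrow> nat \<Rightarrow> (nat \<Rightarrow> real \<times> (real^'dx)) \<Rightarrow> real)
    \<Rightarrow> (nat \<Rightarrow> (nat \<Rightarrow> real \<times> (real^'dx)) \<Rightarrow> real)
    \<Rightarrow> nat \<Rightarrow> (nat \<Rightarrow> real \<times> (real^'dx)) \<Rightarrow> real" where
  "phi_plus g \<Theta> \<theta>0 junk hhat n \<omega> =
     (if \<exists>i<n. fst (\<omega> i) <
           max (g (snd (\<omega> i)) \<theta>0)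
               (plug_in_boundary g \<Theta> \<theta>0 (junk n i \<omega>) n (snd (\<omega> i)) (hhat n \<omega>))
      then 1 else 0)"

definition is_test :: "'o measure \<Rightarrow> ('o \<Rightarrow> real) \<Rightarrow> bool" where
  "is_test S \<psi> \<longleftrightarrow> \<psi> \<in> borel_measurable S \<and> (\<forall>\<omega>\<in>space S. \<psi> \<omega> \<in> {0..1})"

definition asymptotic_level ::
  "(real \<Rightarrow> nat \<Rightarrow> 'o measure) \<Rightarrow> real set \<Rightarrow> real \<Rightarrow> (nat \<Rightarrow> 'o \<Rightarrow> real) \<Rightarrow> bool" where
  "asymptotic_level P H0 \<alpha> \<psi> \<longleftrightarrow>
     (\<forall>h\<in>H0. limsup (\<lambda>n. ereal (\<integral>\<omega>. \<psi> n \<omega> \<partial>P h n)) \<le> ereal \<alpha>)"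

text \<open>
  \<open>S n\<close> is the measurable space of the data, \<open>P h n\<close> the law of the data under the local parameter
  \<open>h\<close>, and \<open>H0\<close>, \<open>H1\<close> are the null and the alternative.
\<close>

definition AUMP ::
  "(nat \<Rightarrow> 'o measure) \<Rightarrow> (real \<Rightarrow> nat \<Rightarrow> 'o measure) \<Rightarrow> real set \<Rightarrow> real set \<Rightarrow> real
    \<Rightarrow> (nat \<Rightarrow> 'o \<Rightarrow> real) \<Rightarrow> bool" where
  "AUMP S P H0 H1 \<alpha> \<phi> \<longleftrightarrow>
     (\<forall>n. is_test (S n) (\<phi> n)) \<and>
     asymptotic_level P H0 \<alpha> \<phi> \<and>
     (\<forall>\<psi>. (\<forall>n. is_test (S n) (\<psi> n)) \<longrightarrow> asymptotic_level P H0 \<alpha> \<psi> \<longrightarrow>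
        (\<forall>h\<in>H1. limsup (\<lambda>n. ereal (\<integral>\<omega>. \<psi> n \<omega> \<partial>P h n))
               \<le> liminf (\<lambda>n. ereal (\<integral>\<omega>. \<phi> n \<omega> \<partial>P h n))))"

end

theory Submission
  imports Defs
begin

text \<open>
  Under the local parameter \<open>h\<close> every observation lies above the curve \<open>g x (\<theta>0 + h/n)\<close>. Moving the curve by
  \<open>O(1/n)\<close> uncovers a strip that a single observation hits with probability \<open>O(1/n)\<close>. Hence the number of observations
  below \<open>g x (\<theta>0 + t/n)\<close> is asymptotically Poisson with mean \<open>max 0 (t - h) / \<lambda>\<close>. The test rejects as soon as
  one observation lies below the estimated curve, or below the null boundary. The curves increase in \<open>\<theta>\<close> near \<open>\<theta>0\<close>, so a
  consistent \<open>hhat\<close> encloses the rejection region between two deterministic ones, and the rejection probability tends to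
  \<open>1 - exp (- max 0 (hbar - h) / \<lambda>)\<close> (lemma \<open>phi_plus_limit\<close>). The choice of \<open>hbar\<close> makes this \<open>\<alpha>\<close> at \<open>h = 0\<close>. It is no
  larger for \<open>h > 0\<close>, and it equals \<open>1 - (1 - \<alpha>) exp (h / \<lambda>)\<close> for \<open>h < 0\<close>.

  No test of asymptotic level \<open>\<alpha>\<close> does better at \<open>h < 0\<close> (lemma \<open>power_envelope\<close>). With probability about
  \<open>1 - exp (h / \<lambda>)\<close> some observation lies below the null boundary, and there any test may reject for free. On the
  complementary event the likelihood ratio between \<open>h\<close> and \<open>0\<close> is asymptotically the constant \<open>exp (h / \<lambda>)\<close>, so a
  test gains at most \<open>exp (h / \<lambda>)\<close> times its null rejection probability. Constancy of the likelihood ratio comes from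
  Hellinger affinities, which multiply over independent observations. Above the null boundary the model is smooth and the
  squared Hellinger distance of one observation is \<open>O(1/n\<^sup>2)\<close>, too small to matter after \<open>n\<close> factors
  (lemmas \<open>iid_power_envelope\<close> and \<open>hellinger_bound\<close>).
\<close>

section \<open>Power of tests on i.i.d. samples\<close>

lemma PiM_density:
  fixes q :: "'a \<Rightarrow> ennreal"
  assumes I: "finite I" and sf: "sigma_finite_measure \<mu>" and sfq: "sigma_finite_measure (density \<mu> q)"
    and q[measurable]: "q \<in> borel_measurable \<mu>"
  shows "PiM I (\<lambda>_. density \<mu> q) = density (PiM I (\<lambda>_. \<mu>)) (\<lambda>\<omega>. \<Prod>i\<in>I. q (\<omega> i))"
proof -
  interpret P: product_sigma_finite "\<lambda>_. \<mu>" using sf by (intro product_sigma_finite.intro)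
  interpret Q: product_sigma_finite "\<lambda>_. density \<mu> q" using sfq by (intro product_sigma_finite.intro)
  have m[measurable]: "(\<lambda>\<omega>. \<Prod>i\<in>I. q (\<omega> i)) \<in> borel_measurable (PiM I (\<lambda>_. \<mu>))"
    using I by measurable
  show ?thesis
  proof (rule Q.PiM_eqI[symmetric, OF I])
    show "sets (density (PiM I (\<lambda>_. \<mu>)) (\<lambda>\<omega>. \<Prod>i\<in>I. q (\<omega> i))) = sets (PiM I (\<lambda>_. density \<mu> q))"
      by (simp cong: sets_PiM_cong)
  next
    fix A assume "\<And>i. i \<in> I \<Longrightarrow> A i \<in> sets (density \<mu> q)"
    then have A: "\<And>i. i \<in> I \<Longrightarrow> A i \<in> sets \<mu>" by simp
    have ind: "indicator (Pi\<^sub>E I A) \<omega> = (\<Prod>i\<in>I. indicator (A i) (\<omega> i) :: ennreal)"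
      if "\<omega> \<in> space (PiM I (\<lambda>_. \<mu>))" for \<omega>
      using that I by (auto simp: indicator_def space_PiM PiE_def prod_zero_iff intro!: prod.neutral)
    have "emeasure (density (PiM I (\<lambda>_. \<mu>)) (\<lambda>\<omega>. \<Prod>i\<in>I. q (\<omega> i))) (Pi\<^sub>E I A)
        = (\<integral>\<^sup>+\<omega>. (\<Prod>i\<in>I. q (\<omega> i)) * indicator (Pi\<^sub>E I A) \<omega> \<partial>PiM I (\<lambda>_. \<mu>))"
      using A I by (intro emeasure_density m sets_PiM_I_finite) auto
    also have "\<dots> = (\<integral>\<^sup>+\<omega>. (\<Prod>i\<in>I. q (\<omega> i) * indicator (A i) (\<omega> i)) \<partial>PiM I (\<lambda>_. \<mu>))"
      by (intro nn_integral_cong) (simp add: ind prod.distrib)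
    also have "\<dots> = (\<Prod>i\<in>I. \<integral>\<^sup>+x. q x * indicator (A i) x \<partial>\<mu>)"
      using A I by (intro P.product_nn_integral_prod) auto
    also have "\<dots> = (\<Prod>i\<in>I. emeasure (density \<mu> q) (A i))"
      using A by (intro prod.cong) (auto simp: emeasure_density)
    finally show "emeasure (density (PiM I (\<lambda>_. \<mu>)) (\<lambda>\<omega>. \<Prod>i\<in>I. q (\<omega> i))) (Pi\<^sub>E I A)
        = (\<Prod>i\<in>I. emeasure (density \<mu> q) (A i))" .
  qed
qed

text \<open>
  The elementary \<open>(1 + a / n)\<^sup>n \<rightarrow> e\<^sup>a\<close> does not suffice, because the crossing probabilities are only
  asymptotic to \<open>a / n\<close>. Since \<open>|u\<^sup>n - v\<^sup>n| \<le> n |u - v|\<close> on the unit interval, replacing \<open>1 - x\<close> by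
  \<open>e\<^sup>-\<^sup>x\<close> costs at most \<open>n x\<^sup>2 = O(1/n)\<close>.
\<close>

lemma power_one_minus_tendsto_exp:
  fixes x :: "nat \<Rightarrow> real"
  assumes lim: "(\<lambda>n. real n * x n) \<longlonglongrightarrow> a" and nonneg: "eventually (\<lambda>n. 0 \<le> x n) sequentially"
  shows "(\<lambda>n. (1 - x n) ^ n) \<longlonglongrightarrow> exp (- a)"
proof -
  have inv: "(\<lambda>n. 1 / real n) \<longlonglongrightarrow> 0" by (rule lim_1_over_n)
  have "(\<lambda>n. (real n * x n) * (1 / real n)) \<longlonglongrightarrow> a * 0"
    by (intro tendsto_mult lim inv)
  moreover have "eventually (\<lambda>n. (real n * x n) * (1 / real n) = x n) sequentially"
    using eventually_gt_at_top[of 0] by eventually_elim simp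
  ultimately have x0: "x \<longlonglongrightarrow> 0" by (auto intro: Lim_transform_eventually)
  have "(\<lambda>n. (real n * x n) * x n) \<longlonglongrightarrow> a * 0"
    by (intro tendsto_mult lim x0)
  then have sq0: "(\<lambda>n. real n * (x n)\<^sup>2) \<longlonglongrightarrow> 0" by (simp add: power2_eq_square mult.assoc)
  have "(\<lambda>n. (1 - x n) ^ n - exp (- (real n * x n))) \<longlonglongrightarrow> 0"
  proof (rule tendsto_rabs_zero_cancel, rule tendsto_sandwich[OF _ _ tendsto_const sq0])
    have "eventually (\<lambda>n. x n < 1) sequentially"
      using x0 by (rule order_tendstoD) simp
    with nonneg show "eventually (\<lambda>n. \<bar>(1 - x n) ^ n - exp (- (real n * x n))\<bar> \<le> real n * (x n)\<^sup>2) sequentially"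
    proof eventually_elim
      case (elim n)
      have e1: "exp (- x n) \<ge> 1 - x n" using exp_ge_add_one_self[of "- x n"] by simp
      have "exp (- x n) \<le> 1 - x n + (x n)\<^sup>2"
      proof -
        have "exp (- x n) = 1 / exp (x n)" by (simp add: exp_minus field_simps)
        also have "\<dots> \<le> 1 / (1 + x n)"
          using exp_ge_add_one_self[of "x n"] elim by (intro divide_left_mono) auto
        also have "\<dots> \<le> 1 - x n + (x n)\<^sup>2"
        proof -
          have "1 \<le> (1 - x n + (x n)\<^sup>2) * (1 + x n)"
            using elim by (simp add: algebra_simps power2_eq_square)
          then show ?thesis using elim by (simp add: divide_le_eq)
        qed
        finally show ?thesis .
      qed
      with e1 have d: "\<bar>(1 - x n) - exp (- x n)\<bar> \<le> (x n)\<^sup>2" by auto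
      have "\<bar>(1 - x n) ^ n - exp (- (real n * x n))\<bar> = norm ((1 - x n) ^ n - exp (- x n) ^ n)"
        by (simp add: exp_of_nat_mult[symmetric])
      also have "\<dots> \<le> real n * norm ((1 - x n) - exp (- x n))"
        using elim by (intro norm_power_diff) auto
      also have "\<dots> \<le> real n * (x n)\<^sup>2"
        using d by (intro mult_left_mono) auto
      finally show ?case .
    qed
  qed (auto)
  moreover have "(\<lambda>n. exp (- (real n * x n))) \<longlonglongrightarrow> exp (- a)"
    by (intro tendsto_exp tendsto_minus lim)
  ultimately have "(\<lambda>n. ((1 - x n) ^ n - exp (- (real n * x n))) + exp (- (real n * x n))) \<longlonglongrightarrow> 0 + exp (- a)"
    by (rule tendsto_add)
  then show ?thesis by simp
qed

lemma prob_density_integral: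
  fixes u :: "'a \<Rightarrow> real"
  assumes [measurable]: "u \<in> borel_measurable \<mu>" and u0: "\<And>z. 0 \<le> u z"
    and ps: "prob_space (density \<mu> (\<lambda>z. ennreal (u z)))"
  shows "integrable \<mu> u" "integral\<^sup>L \<mu> u = 1"
proof -
  interpret prob_space "density \<mu> (\<lambda>z. ennreal (u z))" by fact
  have e: "(\<integral>\<^sup>+z. ennreal (u z) \<partial>\<mu>) = 1"
    using emeasure_space_1 by (simp add: emeasure_density cong: nn_integral_cong)
  show "integrable \<mu> u" using u0 by (intro integrableI_nonneg) (auto simp: e)
  show "integral\<^sup>L \<mu> u = 1"
    using u0 by (subst integral_eq_nn_integral) (auto simp: e)
qed

lemma integrable_sqrt_mult:
  fixes r s :: "'a \<Rightarrow> real"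
  assumes "integrable \<mu> s" "integrable \<mu> r" and r0: "\<And>z. 0 \<le> r z" and s0: "\<And>z. 0 \<le> s z"
  shows "integrable \<mu> (\<lambda>z. sqrt (s z * r z))"
proof (rule Bochner_Integration.integrable_bound)
  show "integrable \<mu> (\<lambda>z. s z + r z)" using assms by auto
  have "sqrt (s z * r z) \<le> s z + r z" for z
    using arith_geo_mean_sqrt[OF s0 r0, of z z] s0[of z] r0[of z] by simp
  then show "AE z in \<mu>. norm (sqrt (s z * r z)) \<le> norm (s z + r z)" using s0 r0 by auto
qed (use assms in auto)

text \<open>
  Under the i.i.d. density \<open>q\<close> the expectation of a test is at most the mass \<open>1 - (\<integral>s)\<^sup>n\<close> of the product of \<open>q\<close> that the
  product \<open>S\<close> of \<open>s\<close> does not cover, plus the integral of the test against \<open>S\<close>. To compare \<open>S\<close> with the multiple \<open>c R\<close> of the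
  null product density, write \<open>\<surd>S = \<surd>(c R) + e\<close>; then \<open>S \<le> (1 + \<delta>) c R + (1 + 1/\<delta>) e\<^sup>2\<close>. The square of
  the error integrates to the last bracket, where the affinity \<open>\<integral>\<surd>(S R) = (\<integral>\<surd>(s r))\<^sup>n\<close> factorizes.
\<close>

lemma iid_power_bound:
  fixes q r s :: "'a \<Rightarrow> real"
  assumes sf: "sigma_finite_measure \<mu>"
    and [measurable]: "q \<in> borel_measurable \<mu>" "r \<in> borel_measurable \<mu>" "s \<in> borel_measurable \<mu>"
    and r0: "\<And>z. 0 \<le> r z" and s0: "\<And>z. 0 \<le> s z" and sq: "\<And>z. s z \<le> q z"
    and pq: "prob_space (density \<mu> (\<lambda>z. ennreal (q z)))"
    and pr: "prob_space (density \<mu> (\<lambda>z. ennreal (r z)))"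
    and psi[measurable]: "\<psi> \<in> borel_measurable (PiM {..<n} (\<lambda>_. \<mu>))"
    and psi01: "\<And>\<omega>. \<omega> \<in> space (PiM {..<n} (\<lambda>_. \<mu>)) \<Longrightarrow> \<psi> \<omega> \<in> {0..1}"
    and c: "0 \<le> c" and \<delta>: "0 < \<delta>"
  shows "(\<integral>\<omega>. \<psi> \<omega> \<partial>PiM {..<n} (\<lambda>_. density \<mu> (\<lambda>z. ennreal (q z))))
     \<le> 1 - (\<integral>z. s z \<partial>\<mu>) ^ n + (1 + \<delta>) * c * (\<integral>\<omega>. \<psi> \<omega> \<partial>PiM {..<n} (\<lambda>_. density \<mu> (\<lambda>z. ennreal (r z))))
       + (1 + 1 / \<delta>) * ((\<integral>z. s z \<partial>\<mu>) ^ n + c - 2 * sqrt c * (\<integral>z. sqrt (s z * r z) \<partial>\<mu>) ^ n)"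
proof -
  interpret P: product_sigma_finite "\<lambda>_. \<mu>" using sf by (intro product_sigma_finite.intro)
  define M where "M = PiM {..<n} (\<lambda>_. \<mu>)"
  define PR where "PR u = (\<lambda>\<omega>. \<Prod>i<n. u (\<omega> i) :: real)" for u :: "'a \<Rightarrow> real"
  have q0: "0 \<le> q z" for z using s0[of z] sq[of z] by linarith
  have iq: "integrable \<mu> q" "integral\<^sup>L \<mu> q = 1" using prob_density_integral[OF _ _ pq] q0 by auto
  have ir: "integrable \<mu> r" "integral\<^sup>L \<mu> r = 1" using prob_density_integral[OF _ _ pr] r0 by auto
  have si: "integrable \<mu> s" using sq s0 q0 by (intro Bochner_Integration.integrable_bound[OF iq(1)]) auto
  have it: "integrable \<mu> (\<lambda>z. sqrt (s z * r z))"
    by (rule integrable_sqrt_mult[OF si ir(1) r0 s0])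
  have PRi: "integrable M (PR u)" "integral\<^sup>L M (PR u) = integral\<^sup>L \<mu> u ^ n" if "integrable \<mu> u" for u
    using P.product_integrable_prod[of "{..<n}" "\<lambda>_. u"] P.product_integral_prod[of "{..<n}" "\<lambda>_. u"] that
    by (auto simp: M_def PR_def)
  have PR0: "0 \<le> PR u \<omega>" if "\<And>z. 0 \<le> u z" for u \<omega>
    unfolding PR_def by (intro prod_nonneg) (auto simp: that)
  have [measurable]: "PR u \<in> borel_measurable M" if [measurable]: "u \<in> borel_measurable \<mu>" for u
    unfolding PR_def M_def by measurable
  have [measurable]: "\<psi> \<in> borel_measurable M" by (simp add: M_def)
  have dens: "(\<integral>\<omega>. \<psi> \<omega> \<partial>PiM {..<n} (\<lambda>_. density \<mu> (\<lambda>z. ennreal (u z)))) = (\<integral>\<omega>. PR u \<omega> * \<psi> \<omega> \<partial>M)"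
    if [measurable]: "u \<in> borel_measurable \<mu>" and u0: "\<And>z. 0 \<le> u z"
      and ps: "prob_space (density \<mu> (\<lambda>z. ennreal (u z)))" for u
  proof -
    have "PiM {..<n} (\<lambda>_. density \<mu> (\<lambda>z. ennreal (u z))) = density M (\<lambda>\<omega>. \<Prod>i<n. ennreal (u (\<omega> i)))"
      unfolding M_def
      by (rule PiM_density) (auto simp: sf intro: prob_space_imp_sigma_finite ps)
    also have "\<dots> = density M (\<lambda>\<omega>. ennreal (PR u \<omega>))"
      by (simp add: PR_def prod_ennreal u0)
    finally have eq: "PiM {..<n} (\<lambda>_. density \<mu> (\<lambda>z. ennreal (u z))) = density M (\<lambda>\<omega>. ennreal (PR u \<omega>))" .
    show ?thesis
      unfolding eq using PR0[of u] u0 by (subst integral_real_density) auto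
  qed
  have int_psi: "integrable M (\<lambda>\<omega>. PR u \<omega> * \<psi> \<omega>)"
    if [measurable]: "u \<in> borel_measurable \<mu>" and u: "integrable \<mu> u" "\<And>z. 0 \<le> u z" for u
  proof (rule Bochner_Integration.integrable_bound[OF PRi(1)[OF u(1)]])
    have "\<psi> \<omega> \<in> {0..1}" if "\<omega> \<in> space M" for \<omega> using psi01 that by (simp add: M_def)
    then show "AE \<omega> in M. norm (PR u \<omega> * \<psi> \<omega>) \<le> norm (PR u \<omega>)"
      using PR0[of u] u by (intro AE_I2) (auto simp: abs_mult intro!: mult_left_le)
  qed measurable
  have sqrtPR: "PR (\<lambda>z. sqrt (s z * r z)) \<omega> = sqrt (PR s \<omega>) * sqrt (PR r \<omega>)" for \<omega>
    unfolding PR_def by (induction n) (auto simp: real_sqrt_mult)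
  have pw: "PR q \<omega> * \<psi> \<omega> \<le> (PR q \<omega> - PR s \<omega>) + (1 + \<delta>) * c * (PR r \<omega> * \<psi> \<omega>)
     + (1 + 1 / \<delta>) * (PR s \<omega> + c * PR r \<omega> - 2 * sqrt c * PR (\<lambda>z. sqrt (s z * r z)) \<omega>)"
    if \<omega>: "\<omega> \<in> space M" for \<omega>
  proof -
    define a b where "a = sqrt (PR s \<omega>)" and "b = sqrt c * sqrt (PR r \<omega>)"
    have p: "0 \<le> \<psi> \<omega>" "\<psi> \<omega> \<le> 1" using psi01 \<omega> by (auto simp: M_def)
    have sp: "PR s \<omega> \<le> PR q \<omega>" unfolding PR_def using sq s0 by (intro prod_mono) auto
    have a2: "PR s \<omega> = a\<^sup>2" using PR0[of s] s0 by (simp add: a_def)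
    have b2: "c * PR r \<omega> = b\<^sup>2" using PR0[of r] r0 c by (simp add: b_def power_mult_distrib)
    have ab: "sqrt c * PR (\<lambda>z. sqrt (s z * r z)) \<omega> = a * b" by (simp add: sqrtPR a_def b_def)
    \<comment> \<open>the weighted inequality between \<open>a\<^sup>2\<close>, \<open>b\<^sup>2\<close> and \<open>(a - b)\<^sup>2\<close>, with its defect as an explicit square\<close>
    have "(1 + 1 / \<delta>) * (a - b)\<^sup>2 - (a\<^sup>2 - (1 + \<delta>) * b\<^sup>2) = (1 / \<delta>) * (a - (1 + \<delta>) * b)\<^sup>2"
      using \<delta> by (simp add: field_simps power2_eq_square)
    moreover have "0 \<le> (1 / \<delta>) * (a - (1 + \<delta>) * b)\<^sup>2" using \<delta> by simp
    ultimately have key: "a\<^sup>2 \<le> (1 + \<delta>) * b\<^sup>2 + (1 + 1 / \<delta>) * (a - b)\<^sup>2" by linarith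
    have "a\<^sup>2 * \<psi> \<omega> \<le> ((1 + \<delta>) * b\<^sup>2 + (1 + 1 / \<delta>) * (a - b)\<^sup>2) * \<psi> \<omega>"
      using key p by (intro mult_right_mono)
    also have "\<dots> = (1 + \<delta>) * b\<^sup>2 * \<psi> \<omega> + ((1 + 1 / \<delta>) * (a - b)\<^sup>2) * \<psi> \<omega>" by (simp add: algebra_simps)
    also have "\<dots> \<le> (1 + \<delta>) * b\<^sup>2 * \<psi> \<omega> + (1 + 1 / \<delta>) * (a - b)\<^sup>2"
      using p \<delta> by (intro add_left_mono mult_left_le) auto
    finally have 1: "PR s \<omega> * \<psi> \<omega> \<le> (1 + \<delta>) * b\<^sup>2 * \<psi> \<omega> + (1 + 1 / \<delta>) * (a - b)\<^sup>2" by (simp add: a2)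
    have "(PR q \<omega> - PR s \<omega>) * \<psi> \<omega> \<le> PR q \<omega> - PR s \<omega>"
      using p sp by (intro mult_left_le) auto
    with 1 have "PR q \<omega> * \<psi> \<omega> \<le> (PR q \<omega> - PR s \<omega>) + (1 + \<delta>) * b\<^sup>2 * \<psi> \<omega> + (1 + 1 / \<delta>) * (a - b)\<^sup>2"
      by (simp add: algebra_simps)
    also have "(a - b)\<^sup>2 = PR s \<omega> + c * PR r \<omega> - 2 * sqrt c * PR (\<lambda>z. sqrt (s z * r z)) \<omega>"
      using a2 b2 ab by (simp add: power2_diff)
    finally show ?thesis by (simp add: b2[symmetric] mult.assoc)
  qed
  note ints = PRi[OF iq(1)] PRi[OF ir(1)] PRi[OF si] PRi[OF it]
  have intr: "integrable M (\<lambda>\<omega>. PR q \<omega> * \<psi> \<omega>)" "integrable M (\<lambda>\<omega>. PR r \<omega> * \<psi> \<omega>)"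
    using int_psi[of q] int_psi[of r] iq ir q0 r0 by auto
  have "(\<integral>\<omega>. \<psi> \<omega> \<partial>PiM {..<n} (\<lambda>_. density \<mu> (\<lambda>z. ennreal (q z)))) = (\<integral>\<omega>. PR q \<omega> * \<psi> \<omega> \<partial>M)"
    using dens[of q] q0 pq by simp
  also have "\<dots> \<le> (\<integral>\<omega>. (PR q \<omega> - PR s \<omega>) + (1 + \<delta>) * c * (PR r \<omega> * \<psi> \<omega>)
     + (1 + 1 / \<delta>) * (PR s \<omega> + c * PR r \<omega> - 2 * sqrt c * PR (\<lambda>z. sqrt (s z * r z)) \<omega>) \<partial>M)"
    using ints intr by (intro integral_mono pw) auto
  also have "\<dots> = 1 - (\<integral>z. s z \<partial>\<mu>) ^ n + (1 + \<delta>) * c * (\<integral>\<omega>. PR r \<omega> * \<psi> \<omega> \<partial>M)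
       + (1 + 1 / \<delta>) * ((\<integral>z. s z \<partial>\<mu>) ^ n + c - 2 * sqrt c * (\<integral>z. sqrt (s z * r z) \<partial>\<mu>) ^ n)"
    using ints intr iq(2) ir(2) by simp
  also have "(\<integral>\<omega>. PR r \<omega> * \<psi> \<omega> \<partial>M) = (\<integral>\<omega>. \<psi> \<omega> \<partial>PiM {..<n} (\<lambda>_. density \<mu> (\<lambda>z. ennreal (r z))))"
    using dens[of r] r0 pr by simp
  finally show ?thesis .
qed


text \<open>
  The one-observation affinity is \<open>\<rho> = (\<integral>s + 1 - H) / 2\<close> with \<open>H = \<integral>(\<surd>s - \<surd>r)\<^sup>2\<close>. When \<open>H = o(1/n)\<close> and
  \<open>1 - \<integral>s\<close> is asymptotic to \<open>a/n\<close>, then \<open>(\<integral>s)\<^sup>n \<rightarrow> c = e\<^sup>-\<^sup>a\<close> and \<open>\<rho>\<^sup>n \<rightarrow> \<surd>c\<close>. Hence the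
  squared error \<open>(\<integral>s)\<^sup>n + c - 2 \<surd>c \<rho>\<^sup>n\<close> of the finite-sample bound tends to \<open>0\<close>: the product of the
  \<open>s\<close> is asymptotically \<open>c\<close> times the null density, and a test of level \<open>\<alpha>\<close> gains at most
  \<open>(1 - c) + c \<alpha>\<close>.
\<close>

theorem iid_power_envelope:
  fixes q s :: "nat \<Rightarrow> 'a \<Rightarrow> real" and r :: "'a \<Rightarrow> real"
  assumes sf: "sigma_finite_measure \<mu>"
    and rm[measurable]: "r \<in> borel_measurable \<mu>" and r0: "\<And>z. 0 \<le> r z"
    and pr: "prob_space (density \<mu> (\<lambda>z. ennreal (r z)))"
    and qm: "\<forall>\<^sub>F n in sequentially. q n \<in> borel_measurable \<mu>"
    and sm: "\<forall>\<^sub>F n in sequentially. s n \<in> borel_measurable \<mu>"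
    and pq: "\<forall>\<^sub>F n in sequentially. prob_space (density \<mu> (\<lambda>z. ennreal (q n z)))"
    and s0: "\<And>n z. 0 \<le> s n z" and sq: "\<And>n z. s n z \<le> q n z"
    and mass: "(\<lambda>n. real n * (1 - (\<integral>z. s n z \<partial>\<mu>))) \<longlonglongrightarrow> a"
    and hellinger: "(\<lambda>n. real n * (\<integral>z. (sqrt (s n z) - sqrt (r z))\<^sup>2 \<partial>\<mu>)) \<longlonglongrightarrow> 0"
    and psi: "\<And>n. \<psi> n \<in> borel_measurable (PiM {..<n} (\<lambda>_. \<mu>))"
    and psi01: "\<And>n \<omega>. \<omega> \<in> space (PiM {..<n} (\<lambda>_. \<mu>)) \<Longrightarrow> \<psi> n \<omega> \<in> {0..1}"
    and level: "limsup (\<lambda>n. ereal (\<integral>\<omega>. \<psi> n \<omega> \<partial>PiM {..<n} (\<lambda>_. density \<mu> (\<lambda>z. ennreal (r z))))) \<le> ereal \<alpha>"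
  shows "limsup (\<lambda>n. ereal (\<integral>\<omega>. \<psi> n \<omega> \<partial>PiM {..<n} (\<lambda>_. density \<mu> (\<lambda>z. ennreal (q n z)))))
    \<le> ereal (1 - exp (- a) * (1 - \<alpha>))"
proof -
  define c where "c = exp (- a)"
  define Es where "Es n = (\<integral>z. s n z \<partial>\<mu>)" for n
  define Hn where "Hn n = (\<integral>z. (sqrt (s n z) - sqrt (r z))\<^sup>2 \<partial>\<mu>)" for n
  define \<rho> where "\<rho> n = (\<integral>z. sqrt (s n z * r z) \<partial>\<mu>)" for n
  define eq where "eq n = (\<integral>\<omega>. \<psi> n \<omega> \<partial>PiM {..<n} (\<lambda>_. density \<mu> (\<lambda>z. ennreal (q n z))))" for n
  define er where "er n = (\<integral>\<omega>. \<psi> n \<omega> \<partial>PiM {..<n} (\<lambda>_. density \<mu> (\<lambda>z. ennreal (r z))))" for n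
  have q0: "0 \<le> q n z" for n z using s0[of n z] sq[of n z] by linarith
  have c0: "0 < c" by (simp add: c_def)
  have sqc: "sqrt c = exp (- (a / 2))"
    by (rule real_sqrt_unique) (simp_all add: c_def power2_eq_square exp_add[symmetric])
  have ir: "integrable \<mu> r" "integral\<^sup>L \<mu> r = 1" using prob_density_integral[OF rm r0 pr] .
  have ev: "\<forall>\<^sub>F n in sequentially. 0 \<le> 1 - Es n \<and> \<rho> n = (Es n + 1 - Hn n) / 2"
    using qm sm pq
  proof eventually_elim
    case (elim n)
    note [measurable] = elim(1,2)
    have iq: "integrable \<mu> (q n)" "integral\<^sup>L \<mu> (q n) = 1"
      using prob_density_integral[OF elim(1) q0 elim(3)] .
    have si: "integrable \<mu> (s n)"
      using sq s0 q0 by (intro Bochner_Integration.integrable_bound[OF iq(1)]) auto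
    have it: "integrable \<mu> (\<lambda>z. sqrt (s n z * r z))"
      by (rule integrable_sqrt_mult[OF si ir(1) r0 s0])
    have "Es n \<le> integral\<^sup>L \<mu> (q n)"
      unfolding Es_def using si iq sq by (intro integral_mono) auto
    moreover have "Hn n = (\<integral>z. s n z + r z - 2 * sqrt (s n z * r z) \<partial>\<mu>)"
      unfolding Hn_def using s0 r0
      by (intro Bochner_Integration.integral_cong) (auto simp: power2_diff real_sqrt_mult)
    moreover have "\<dots> = Es n + 1 - 2 * \<rho> n"
      using si ir it by (simp add: Es_def \<rho>_def)
    ultimately show ?case using iq by auto
  qed
  have Esn: "(\<lambda>n. Es n ^ n) \<longlonglongrightarrow> c"
  proof -
    have "(\<lambda>n. (1 - (1 - Es n)) ^ n) \<longlonglongrightarrow> exp (- a)"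
      using ev by (intro power_one_minus_tendsto_exp) (auto simp: Es_def mass elim: eventually_mono)
    then show ?thesis by (simp add: c_def)
  qed
  have rn: "(\<lambda>n. \<rho> n ^ n) \<longlonglongrightarrow> sqrt c"
  proof -
    have "(\<lambda>n. (real n * (1 - Es n) + real n * Hn n) / 2) \<longlonglongrightarrow> (a + 0) / 2"
      unfolding Es_def Hn_def by (intro tendsto_divide tendsto_add mass hellinger tendsto_const) simp
    moreover have "\<forall>\<^sub>F n in sequentially. (real n * (1 - Es n) + real n * Hn n) / 2 = real n * (1 - \<rho> n)"
      using ev
    proof eventually_elim
      case (elim n)
      then have \<rho>: "\<rho> n = (Es n + 1 - Hn n) / 2" by simp
      show ?case unfolding \<rho> by (simp add: field_simps)
    qed
    ultimately have "(\<lambda>n. real n * (1 - \<rho> n)) \<longlonglongrightarrow> a / 2" by (auto intro: Lim_transform_eventually)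
    moreover have "\<forall>\<^sub>F n in sequentially. 0 \<le> 1 - \<rho> n"
      using ev
    proof eventually_elim
      case (elim n)
      have "0 \<le> Hn n" unfolding Hn_def by (intro Bochner_Integration.integral_nonneg_AE) auto
      then show ?case using elim by auto
    qed
    ultimately have "(\<lambda>n. (1 - (1 - \<rho> n)) ^ n) \<longlonglongrightarrow> exp (- (a / 2))"
      by (rule power_one_minus_tendsto_exp)
    then show ?thesis by (simp add: sqc)
  qed
  have bound: "\<forall>\<^sub>F n in sequentially. eq n \<le> 1 - Es n ^ n + (1 + \<delta>) * c * er n
      + (1 + 1 / \<delta>) * (Es n ^ n + c - 2 * sqrt c * \<rho> n ^ n)" if \<delta>: "0 < \<delta>" for \<delta>
    using qm sm pq
    by eventually_elim
       (unfold eq_def er_def Es_def \<rho>_def, rule iid_power_bound; (use sf rm r0 s0 sq pr psi psi01 c0 \<delta> in auto)[1])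
  have "limsup (\<lambda>n. ereal (eq n)) \<le> ereal (1 - c * (1 - \<alpha>)) + ereal \<epsilon>" if \<epsilon>: "0 < \<epsilon>" for \<epsilon>
  proof -
    have "((\<lambda>\<delta>. (1 + \<delta>) * c * (\<alpha> + \<delta>)) \<longlongrightarrow> (1 + 0) * c * (\<alpha> + 0)) (at_right 0)"
      by (intro tendsto_intros)
    then have "\<forall>\<^sub>F \<delta> in at_right 0. (1 + \<delta>) * c * (\<alpha> + \<delta>) < c * \<alpha> + \<epsilon> / 2"
      by (rule order_tendstoD) (use \<epsilon> in simp)
    moreover have "\<forall>\<^sub>F \<delta> in at_right (0::real). 0 < \<delta>" by (simp add: eventually_at_filter)
    ultimately have "\<forall>\<^sub>F \<delta> in at_right 0. (1 + \<delta>) * c * (\<alpha> + \<delta>) < c * \<alpha> + \<epsilon> / 2 \<and> 0 < \<delta>"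
      by (rule eventually_conj)
    then obtain \<delta> where \<delta>: "0 < \<delta>" "(1 + \<delta>) * c * (\<alpha> + \<delta>) < c * \<alpha> + \<epsilon> / 2"
      using eventually_happens'[OF trivial_limit_at_right_real] by blast
    have "limsup (\<lambda>n. ereal (er n)) < ereal (\<alpha> + \<delta>)"
      using level \<delta> by (auto simp: er_def intro: le_less_trans)
    then have e1: "\<forall>\<^sub>F n in sequentially. er n < \<alpha> + \<delta>"
      by (auto dest: Limsup_lessD)
    have "(\<lambda>n. 1 - Es n ^ n + (1 + 1 / \<delta>) * (Es n ^ n + c - 2 * sqrt c * \<rho> n ^ n))
        \<longlonglongrightarrow> 1 - c + (1 + 1 / \<delta>) * (c + c - 2 * sqrt c * sqrt c)"
      by (intro tendsto_intros Esn rn)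
    also have "1 - c + (1 + 1 / \<delta>) * (c + c - 2 * sqrt c * sqrt c) = 1 - c"
      using c0 by simp
    finally have e2: "\<forall>\<^sub>F n in sequentially.
        1 - Es n ^ n + (1 + 1 / \<delta>) * (Es n ^ n + c - 2 * sqrt c * \<rho> n ^ n) < 1 - c + \<epsilon> / 2"
      by (rule order_tendstoD) (use \<epsilon> in simp)
    have "\<forall>\<^sub>F n in sequentially. ereal (eq n) \<le> ereal (1 - c * (1 - \<alpha>) + \<epsilon>)"
      using bound[OF \<delta>(1)] e1 e2
    proof eventually_elim
      case (elim n)
      have "(1 + \<delta>) * c * er n \<le> (1 + \<delta>) * c * (\<alpha> + \<delta>)"
        using elim c0 \<delta> by (intro mult_left_mono) auto
      then have "eq n \<le> 1 - c + \<epsilon> / 2 + (c * \<alpha> + \<epsilon> / 2)" using elim \<delta> by linarith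
      then show ?case by (simp add: algebra_simps)
    qed
    then have "limsup (\<lambda>n. ereal (eq n)) \<le> ereal (1 - c * (1 - \<alpha>) + \<epsilon>)" by (rule Limsup_bounded)
    then show ?thesis by simp
  qed
  then have "limsup (\<lambda>n. ereal (eq n)) \<le> ereal (1 - c * (1 - \<alpha>))" by (rule ereal_le_epsilon2) auto
  then show ?thesis by (simp add: eq_def c_def)
qed

section \<open>Integrals over the sample space and over shrinking intervals\<close>

lemma sets_sample_law: "sets (sample_law \<Y> pX f g \<beta> n) = sets (sample_space \<Y> pX n)"
  unfolding sample_law_def sample_space_def obs_law_def by (intro sets_PiM_cong) auto

lemma space_dom_measure:
  "space (dom_measure \<Y> pX) = \<Y> \<times> set_pmf pX"
  by (simp add: dom_measure_def lebesgue_on_Y_def space_pair_measure space_restrict_space)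

lemma sigma_finite_lebesgue_on_Y: "\<Y> \<in> sets borel \<Longrightarrow> sigma_finite_measure (lebesgue_on_Y \<Y>)"
  unfolding lebesgue_on_Y_def
  by (intro sigma_finite_measure_restrict_space) (auto intro: sigma_finite_lborel)

lemma sigma_finite_dom_measure:
  assumes "\<Y> \<in> sets borel" "finite (set_pmf pX)"
  shows "sigma_finite_measure (dom_measure \<Y> pX)"
proof -
  interpret A: sigma_finite_measure "lebesgue_on_Y \<Y>" using sigma_finite_lebesgue_on_Y assms by blast
  interpret B: sigma_finite_measure "count_space (set_pmf pX)"
    using assms by (intro sigma_finite_measure_count_space_finite)
  interpret pair_sigma_finite "lebesgue_on_Y \<Y>" "count_space (set_pmf pX)" ..
  show ?thesis unfolding dom_measure_def by unfold_locales
qed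

lemma borel_measurable_dom_measureI:
  assumes "finite (set_pmf pX)" "\<And>x. x \<in> set_pmf pX \<Longrightarrow> (\<lambda>y. G (y, x)) \<in> measurable (lebesgue_on_Y \<Y>) N"
  shows "G \<in> measurable (dom_measure \<Y> pX) N"
proof -
  have "(\<lambda>z. (\<lambda>x z. G (fst z, x)) (snd z) z) \<in> measurable (dom_measure \<Y> pX) N"
    unfolding dom_measure_def
    by (rule measurable_compose_countable'[where I = "set_pmf pX"])
       (use assms in \<open>auto intro!: measurable_compose[OF measurable_fst] countable_finite\<close>)
  then show ?thesis by simp
qed

lemma nn_integral_dom_measure:
  assumes "\<Y> \<in> sets borel" "finite (set_pmf pX)" "G \<in> borel_measurable (dom_measure \<Y> pX)"
  shows "(\<integral>\<^sup>+z. G z \<partial>dom_measure \<Y> pX) = (\<Sum>x\<in>set_pmf pX. \<integral>\<^sup>+y. G (y, x) \<partial>lebesgue_on_Y \<Y>)"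
proof -
  interpret A: sigma_finite_measure "lebesgue_on_Y \<Y>" using sigma_finite_lebesgue_on_Y assms by blast
  interpret B: sigma_finite_measure "count_space (set_pmf pX)"
    using assms by (intro sigma_finite_measure_count_space_finite)
  interpret pair_sigma_finite "lebesgue_on_Y \<Y>" "count_space (set_pmf pX)" ..
  show ?thesis
    using nn_integral_snd[of G] assms
    by (simp add: dom_measure_def nn_integral_count_space_finite)
qed

lemma difference_quotient_sequence:
  fixes \<phi> :: "real \<Rightarrow> real"
  assumes "(\<phi> has_real_derivative D) (at x)"
  shows "(\<lambda>n. real n * (\<phi> (x + t / real n) - \<phi> x)) \<longlonglongrightarrow> t * D"
proof (cases "t = 0")
  case False
  have l: "((\<lambda>k. (\<phi> (x + k) - \<phi> x) / k) \<longlongrightarrow> D) (at 0)"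
    using assms by (simp add: DERIV_def)
  have "(\<lambda>n. t / real n) \<longlonglongrightarrow> 0" by (rule lim_const_over_n)
  then have "filterlim (\<lambda>n. t / real n) (at 0) sequentially"
    using False by (auto simp: filterlim_at intro!: eventually_mono[OF eventually_gt_at_top[of 0]])
  from filterlim_compose[OF l this]
  have "(\<lambda>n. t * ((\<phi> (x + t / real n) - \<phi> x) / (t / real n))) \<longlonglongrightarrow> t * D"
    by (intro tendsto_mult tendsto_const)
  moreover have "t * ((\<phi> (x + t / real n) - \<phi> x) / (t / real n)) = real n * (\<phi> (x + t / real n) - \<phi> x)" for n
    using False by (cases "n = 0") auto
  ultimately show ?thesis by simp
qed simp

text \<open>
  On shrinking intervals next to \<open>c\<close> the integrand is uniformly close to \<open>v\<close>, so that the integral is \<open>v\<close> times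
  the length of the interval up to \<open>o(1/n)\<close>. The point \<open>c\<close> must be interior to
  \<open>\<Y>\<close>, for otherwise the interval would lose some of its length.
\<close>

lemma tendsto_scaled_interval_integral:
  fixes F :: "nat \<Rightarrow> real \<Rightarrow> real"
  assumes Y: "\<Y> \<in> sets borel" and c: "c \<in> interior \<Y>"
    and meas: "\<forall>\<^sub>F n in sequentially. (\<lambda>y. F n y * indicator {a n..<b n} y) \<in> borel_measurable (lebesgue_on_Y \<Y>)"
    and a: "a \<longlonglongrightarrow> c" and b: "b \<longlonglongrightarrow> c" and ab: "\<forall>\<^sub>F n in sequentially. a n \<le> b n"
    and len: "(\<lambda>n. real n * (b n - a n)) \<longlonglongrightarrow> L"
    and cont: "\<And>\<eta>. 0 < \<eta> \<Longrightarrow> \<exists>\<delta>>0. \<forall>\<^sub>F n in sequentially. \<forall>y\<in>\<Y>. \<bar>y - c\<bar> < \<delta> \<longrightarrow> \<bar>F n y - v\<bar> \<le> \<eta>"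
  shows "(\<lambda>n. real n * (\<integral>y. F n y * indicator {a n..<b n} y \<partial>lebesgue_on_Y \<Y>)) \<longlonglongrightarrow> v * L"
proof -
  define J where "J n = (\<integral>y. F n y * indicator {a n..<b n} y \<partial>lebesgue_on_Y \<Y>)" for n
  obtain e where e: "0 < e" "\<And>y. \<bar>y - c\<bar> < e \<Longrightarrow> y \<in> \<Y>"
    using c by (auto simp: mem_interior subset_iff dist_real_def abs_minus_commute)
  have close: "\<forall>\<^sub>F n in sequentially. \<bar>J n - v * (b n - a n)\<bar> \<le> \<eta> * (b n - a n)" if \<eta>: "0 < \<eta>" for \<eta>
  proof -
    \<comment> \<open>near \<open>c\<close> the integrand lies within \<open>\<eta>\<close> of \<open>v\<close>, so it is sandwiched between two multiples of an indicator\<close>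
    obtain \<delta> where \<delta>: "0 < \<delta>" and F: "\<forall>\<^sub>F n in sequentially. \<forall>y\<in>\<Y>. \<bar>y - c\<bar> < \<delta> \<longrightarrow> \<bar>F n y - v\<bar> \<le> \<eta>"
      using cont[OF \<eta>] by blast
    define d where "d = min \<delta> e"
    have d: "0 < d" "d \<le> \<delta>" "d \<le> e" using \<delta> e by (auto simp: d_def)
    have "\<forall>\<^sub>F n in sequentially. c - d < a n" "\<forall>\<^sub>F n in sequentially. b n < c + d"
      using order_tendstoD[OF a] order_tendstoD[OF b] d by auto
    then show ?thesis using F ab meas
    proof eventually_elim
      case (elim n)
      have in_ab: "\<bar>y - c\<bar> < d" if "y \<in> {a n..<b n}" for y using that elim by auto
      have sub: "{a n..<b n} \<subseteq> \<Y>" using in_ab d e by force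
      have bnd: "(v - \<eta>) * indicator {a n..<b n} y \<le> F n y * indicator {a n..<b n} y"
        "F n y * indicator {a n..<b n} y \<le> (v + \<eta>) * indicator {a n..<b n} y" for y
      proof -
        have "\<bar>F n y - v\<bar> \<le> \<eta>" if "y \<in> {a n..<b n}"
          using elim(3) in_ab[OF that] d sub that by auto
        then show "(v - \<eta>) * indicator {a n..<b n} y \<le> F n y * indicator {a n..<b n} y"
        "F n y * indicator {a n..<b n} y \<le> (v + \<eta>) * indicator {a n..<b n} y"
          by (auto simp: indicator_def abs_le_iff)
      qed
      have ia: "(\<lambda>y. indicator \<Y> y * indicator {a n..<b n} y :: real) = indicator {a n..<b n}"
        using sub by (intro ext) (auto split: split_indicator)
      have ii: "integrable (lebesgue_on_Y \<Y>) (indicator {a n..<b n} :: real \<Rightarrow> real)"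
        unfolding lebesgue_on_Y_def using Y elim by (subst integrable_restrict_space) (auto simp: ia)
      have iv: "(\<integral>y. indicator {a n..<b n} y \<partial>lebesgue_on_Y \<Y>) = b n - a n"
        unfolding lebesgue_on_Y_def using Y elim by (subst integral_restrict_space) (auto simp: ia)
      have iF: "integrable (lebesgue_on_Y \<Y>) (\<lambda>y. F n y * indicator {a n..<b n} y)"
      proof (rule Bochner_Integration.integrable_bound)
        show "integrable (lebesgue_on_Y \<Y>) (\<lambda>y. (\<bar>v\<bar> + \<eta>) * indicator {a n..<b n} y :: real)" using ii by auto
        have "norm (F n y * indicator {a n..<b n} y) \<le> norm ((\<bar>v\<bar> + \<eta>) * indicator {a n..<b n} y :: real)" for y
        proof (cases "y \<in> {a n..<b n}")
          case True
          then have "v - \<eta> \<le> F n y" "F n y \<le> v + \<eta>" using bnd[of y] by auto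
          then have "\<bar>F n y\<bar> \<le> \<bar>v\<bar> + \<eta>" by arith
          then show ?thesis using True by simp
        qed simp
        then show "AE y in lebesgue_on_Y \<Y>. norm (F n y * indicator {a n..<b n} y) \<le> norm ((\<bar>v\<bar> + \<eta>) * indicator {a n..<b n} y :: real)"
          by blast
      qed (use elim in auto)
      have "(\<integral>y. (v - \<eta>) * indicator {a n..<b n} y \<partial>lebesgue_on_Y \<Y>) \<le> J n"
        unfolding J_def using ii iF bnd by (intro integral_mono) auto
      moreover have "J n \<le> (\<integral>y. (v + \<eta>) * indicator {a n..<b n} y \<partial>lebesgue_on_Y \<Y>)"
        unfolding J_def using ii iF bnd by (intro integral_mono) auto
      moreover have "(\<integral>y. k * indicator {a n..<b n} y \<partial>lebesgue_on_Y \<Y>) = k * (b n - a n)" for k :: real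
        by (simp only: integral_mult_right_zero iv)
      ultimately have "(v - \<eta>) * (b n - a n) \<le> J n" "J n \<le> (v + \<eta>) * (b n - a n)"
        by (simp_all only:)
      then show ?case by (simp add: abs_le_iff algebra_simps)
    qed
  qed
  have "(\<lambda>n. real n * J n - v * (real n * (b n - a n))) \<longlonglongrightarrow> 0"
  proof (rule tendstoI)
    fix \<epsilon> :: real assume \<epsilon>: "0 < \<epsilon>"
    define \<eta> where "\<eta> = \<epsilon> / (2 * (\<bar>L\<bar> + 1))"
    have \<eta>: "0 < \<eta>" using \<epsilon> by (simp add: \<eta>_def add_nonneg_pos)
    have "\<forall>\<^sub>F n in sequentially. real n * (b n - a n) < \<bar>L\<bar> + 1"
      using len by (rule order_tendstoD) simp
    then show "\<forall>\<^sub>F n in sequentially. dist (real n * J n - v * (real n * (b n - a n))) 0 < \<epsilon>"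
      using close[OF \<eta>]
    proof eventually_elim
      case (elim n)
      have "real n * J n - v * (real n * (b n - a n)) = real n * (J n - v * (b n - a n))"
        by (simp add: algebra_simps)
      then have "\<bar>real n * J n - v * (real n * (b n - a n))\<bar> = real n * \<bar>J n - v * (b n - a n)\<bar>"
        by (simp add: abs_mult)
      also have "\<dots> \<le> real n * (\<eta> * (b n - a n))" using elim by (intro mult_left_mono) auto
      also have "\<dots> = \<eta> * (real n * (b n - a n))" by simp
      also have "\<dots> \<le> \<eta> * (\<bar>L\<bar> + 1)" using elim \<eta> by (intro mult_left_mono) auto
      also have "\<dots> = \<epsilon> / 2" using abs_ge_zero[of L] by (simp add: \<eta>_def field_simps)
      also have "\<dots> < \<epsilon>" using \<epsilon> by simp
      finally show ?case by simp
    qed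
  qed
  from tendsto_add[OF this tendsto_mult[OF tendsto_const[of v] len]]
  show ?thesis by (simp add: J_def)
qed

section \<open>Crossing probabilities in a boundary model\<close>

text \<open>
  The regularity conditions along the line \<open>\<theta> \<mapsto> (\<theta>, \<gamma>)\<close>, on a ball about \<open>\<theta>0\<close>. The nuisance parameter is the
  same under all local laws, so only derivatives in \<open>\<theta>\<close> enter: \<open>D\<close> is the \<open>\<theta>\<close>-derivative of the density and
  \<open>G\<close> that of the boundary at \<open>\<theta>0\<close>. The integral condition is a dominated version of finite Fisher information
  of the smooth part.
\<close>

locale boundary_model =
  fixes \<Y> :: "real set" and pX :: "(real^'dx) pmf"
    and f :: "real \<Rightarrow> real^'dx \<Rightarrow> real \<times> (real^'d) \<Rightarrow> real"
    and g :: "real^'dx \<Rightarrow> real \<Rightarrow> real"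
    and \<gamma> :: "real^'d" and \<theta>0 d C :: real
    and D :: "real \<Rightarrow> real^'dx \<Rightarrow> real \<Rightarrow> real" and G :: "real^'dx \<Rightarrow> real"
  assumes Y: "\<Y> \<in> sets borel" and fin: "finite (set_pmf pX)" and d: "0 < d"
    and bnd_int: "x \<in> set_pmf pX \<Longrightarrow> g x \<theta>0 \<in> interior \<Y>"
    and cond_meas: "x \<in> set_pmf pX \<Longrightarrow> \<theta> \<in> ball \<theta>0 d \<Longrightarrow>
        cond_density f g (\<theta>, \<gamma>) x \<in> borel_measurable (lebesgue_on_Y \<Y>)"
    and cond_total: "x \<in> set_pmf pX \<Longrightarrow> \<theta> \<in> ball \<theta>0 d \<Longrightarrow>
        (\<integral>\<^sup>+ y. ennreal (cond_density f g (\<theta>, \<gamma>) x y) \<partial>lebesgue_on_Y \<Y>) = 1"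
    and f_pos: "x \<in> set_pmf pX \<Longrightarrow> y \<in> \<Y> \<Longrightarrow> \<theta> \<in> ball \<theta>0 d \<Longrightarrow> 0 < f y x (\<theta>, \<gamma>)"
    and f_deriv: "x \<in> set_pmf pX \<Longrightarrow> y \<in> \<Y> \<Longrightarrow> \<theta> \<in> ball \<theta>0 d \<Longrightarrow>
        ((\<lambda>\<theta>. f y x (\<theta>, \<gamma>)) has_real_derivative D y x \<theta>) (at \<theta>)"
    and D_bound: "x \<in> set_pmf pX \<Longrightarrow> y \<in> \<Y> \<Longrightarrow> \<theta> \<in> ball \<theta>0 d \<Longrightarrow> \<bar>D y x \<theta>\<bar> \<le> C"
    and f_cont: "x \<in> set_pmf pX \<Longrightarrow> continuous_on \<Y> (\<lambda>y. f y x (\<theta>0, \<gamma>))"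
    and info: "x \<in> set_pmf pX \<Longrightarrow>
        (\<integral>\<^sup>+ y. (SUP \<theta>\<in>ball \<theta>0 d. ennreal ((D y x \<theta>)\<^sup>2 / f y x (\<theta>, \<gamma>) * indicator {g x \<theta>..} y))
          \<partial>lebesgue_on_Y \<Y>) < \<infinity>"
    and g_deriv: "x \<in> set_pmf pX \<Longrightarrow> (g x has_real_derivative G x) (at \<theta>0)"
    and G_pos: "x \<in> set_pmf pX \<Longrightarrow> 0 < G x"
    and g_mono: "x \<in> set_pmf pX \<Longrightarrow> mono_on (ball \<theta>0 d) (g x)"
begin

text \<open>
  The reciprocal of the constant \<open>\<lambda>\<close>: the intensity, per unit of the local parameter, with which observations
  appear between two boundary curves.
\<close>

definition rate :: real where
  "rate = (\<Sum>x\<in>set_pmf pX. pmf pX x * (f (g x \<theta>0) x (\<theta>0, \<gamma>) * G x))"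

text \<open>
  Truncation at \<open>0\<close> only affects points outside the sample space; it makes the density nonnegative everywhere.
\<close>

definition obs_density :: "real \<Rightarrow> real \<times> (real^'dx) \<Rightarrow> real" where
  "obs_density \<theta> = (\<lambda>(y, x). max 0 (pmf pX x * cond_density f g (\<theta>, \<gamma>) x y))"

definition crossing_prob :: "real \<Rightarrow> real \<Rightarrow> real" where
  "crossing_prob \<theta> u = measure (obs_law \<Y> pX f g (\<theta>, \<gamma>)) {z \<in> \<Y> \<times> set_pmf pX. fst z < g (snd z) u}"

abbreviation "P \<equiv> local_law \<Y> pX f g \<theta>0 \<gamma>"

lemma obs_density_nonneg: "0 \<le> obs_density \<theta> z" by (auto simp: obs_density_def split: prod.split)

lemma obs_density_eq:
  assumes "x \<in> set_pmf pX" "y \<in> \<Y>" "\<theta> \<in> ball \<theta>0 d"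
  shows "obs_density \<theta> (y, x) = pmf pX x * (f y x (\<theta>, \<gamma>) * indicator {g x \<theta>..} y)"
  using f_pos[OF assms] by (simp add: obs_density_def cond_density_def)

lemma obs_law_eq_density: "obs_law \<Y> pX f g (\<theta>, \<gamma>) = density (dom_measure \<Y> pX) (\<lambda>z. ennreal (obs_density \<theta> z))"
  unfolding obs_law_def obs_density_def
  by (rule arg_cong[where f = "density _"]) (auto simp: fun_eq_iff max_def ennreal_neg)

lemma local_law_eq:
  "P h n = PiM {..<n} (\<lambda>_. density (dom_measure \<Y> pX) (\<lambda>z. ennreal (obs_density (\<theta>0 + h / real n) z)))"
  by (simp add: local_law_def sample_law_def obs_law_eq_density)

lemma obs_density_measurable: "\<theta> \<in> ball \<theta>0 d \<Longrightarrow> obs_density \<theta> \<in> borel_measurable (dom_measure \<Y> pX)"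
  using cond_meas by (intro borel_measurable_dom_measureI fin) (auto simp: obs_density_def)

lemma below_measurable_Y: "{..<b} \<inter> \<Y> \<in> sets (lebesgue_on_Y \<Y>)"
  using Y by (auto simp: lebesgue_on_Y_def sets_restrict_space)

lemma space_lebesgue_on_Y: "space (lebesgue_on_Y \<Y>) = \<Y>"
  by (simp add: lebesgue_on_Y_def space_restrict_space)

lemma cond_density_integrable:
  assumes "x \<in> set_pmf pX" "\<theta> \<in> ball \<theta>0 d"
  shows "integrable (lebesgue_on_Y \<Y>) (cond_density f g (\<theta>, \<gamma>) x)"
  using cond_meas[OF assms] cond_total[OF assms] f_pos[OF assms(1) _ assms(2)]
  by (intro integrableI_nonneg AE_I2) (auto simp: space_lebesgue_on_Y cond_density_def less_imp_le)

lemma nn_integral_obs_density: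
  assumes \<theta>: "\<theta> \<in> ball \<theta>0 d" and u: "u \<in> borel_measurable (dom_measure \<Y> pX)"
  shows "(\<integral>\<^sup>+z. ennreal (obs_density \<theta> z) * u z \<partial>dom_measure \<Y> pX)
    = (\<Sum>x\<in>set_pmf pX. \<integral>\<^sup>+y. ennreal (pmf pX x) * ennreal (cond_density f g (\<theta>, \<gamma>) x y) * u (y, x) \<partial>lebesgue_on_Y \<Y>)"
proof -
  note [measurable] = obs_density_measurable[OF \<theta>] u
  have "(\<integral>\<^sup>+z. ennreal (obs_density \<theta> z) * u z \<partial>dom_measure \<Y> pX)
     = (\<Sum>x\<in>set_pmf pX. \<integral>\<^sup>+y. ennreal (obs_density \<theta> (y, x)) * u (y, x) \<partial>lebesgue_on_Y \<Y>)"
    using Y fin by (subst nn_integral_dom_measure) auto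
  also have "\<dots> = (\<Sum>x\<in>set_pmf pX. \<integral>\<^sup>+y. ennreal (pmf pX x) * ennreal (cond_density f g (\<theta>, \<gamma>) x y) * u (y, x) \<partial>lebesgue_on_Y \<Y>)"
    using f_pos \<theta>
    by (intro sum.cong refl nn_integral_cong)
       (auto simp: obs_density_eq space_lebesgue_on_Y cond_density_def less_imp_le ennreal_mult[symmetric])
  finally show ?thesis .
qed

lemma prob_space_obs:
  assumes \<theta>: "\<theta> \<in> ball \<theta>0 d"
  shows "prob_space (density (dom_measure \<Y> pX) (\<lambda>z. ennreal (obs_density \<theta> z)))"
proof (rule prob_spaceI)
  note [measurable] = obs_density_measurable[OF \<theta>]
  have "emeasure (density (dom_measure \<Y> pX) (\<lambda>z. ennreal (obs_density \<theta> z))) (space (density (dom_measure \<Y> pX) (\<lambda>z. ennreal (obs_density \<theta> z))))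
     = (\<integral>\<^sup>+z. ennreal (obs_density \<theta> z) * 1 \<partial>dom_measure \<Y> pX)"
    by (simp add: emeasure_density cong: nn_integral_cong)
  also have "\<dots> = (\<Sum>x\<in>set_pmf pX. ennreal (pmf pX x))"
    using cond_meas[OF _ \<theta>] cond_total[OF _ \<theta>] by (subst nn_integral_obs_density[OF \<theta>]) (auto simp: nn_integral_cmult)
  also have "\<dots> = 1" using fin by (simp add: sum_ennreal sum_pmf_eq_1)
  finally show "emeasure (density (dom_measure \<Y> pX) (\<lambda>z. ennreal (obs_density \<theta> z))) (space (density (dom_measure \<Y> pX) (\<lambda>z. ennreal (obs_density \<theta> z)))) = 1" .
qed

lemma below_measurable: "{z \<in> \<Y> \<times> set_pmf pX. fst z < u (snd z)} \<in> sets (dom_measure \<Y> pX)"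
proof -
  have "(\<lambda>z. fst z < u (snd z)) \<in> measurable (dom_measure \<Y> pX) (count_space UNIV)"
  proof (intro borel_measurable_dom_measureI fin)
    fix x
    have "{y \<in> \<Y>. y < u x} = {..<u x} \<inter> \<Y>" by auto
    then show "(\<lambda>y. fst (y, x) < u (snd (y, x))) \<in> measurable (lebesgue_on_Y \<Y>) (count_space UNIV)"
      using below_measurable_Y by (simp add: pred_def space_lebesgue_on_Y)
  qed
  then show ?thesis by (simp add: pred_def space_dom_measure)
qed

lemma crossing_prob_eq:
  assumes \<theta>: "\<theta> \<in> ball \<theta>0 d"
  shows "crossing_prob \<theta> u
    = (\<Sum>x\<in>set_pmf pX. pmf pX x * (\<integral>y. f y x (\<theta>, \<gamma>) * indicator {g x \<theta>..<g x u} y \<partial>lebesgue_on_Y \<Y>))"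
proof -
  define B where "B = {z \<in> \<Y> \<times> set_pmf pX. fst z < g (snd z) u}"
  define J where "J x = (\<integral>y. f y x (\<theta>, \<gamma>) * indicator {g x \<theta>..<g x u} y \<partial>lebesgue_on_Y \<Y>)" for x
  have B[measurable]: "B \<in> sets (dom_measure \<Y> pX)" unfolding B_def by (rule below_measurable)
  note [measurable] = obs_density_measurable[OF \<theta>]
  have J: "(\<integral>\<^sup>+y. ennreal (pmf pX x) * ennreal (cond_density f g (\<theta>, \<gamma>) x y) * indicator B (y, x) \<partial>lebesgue_on_Y \<Y>)
     = ennreal (pmf pX x * J x)" and J0: "0 \<le> J x" if x: "x \<in> set_pmf pX" for x
  proof -
    note [measurable] = cond_meas[OF x \<theta>] below_measurable_Y
    have eq: "cond_density f g (\<theta>, \<gamma>) x y * indicator ({..<g x u} \<inter> \<Y>) y = f y x (\<theta>, \<gamma>) * indicator {g x \<theta>..<g x u} y"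
      if "y \<in> \<Y>" for y using that by (auto simp: cond_density_def indicator_def)
    have int: "integrable (lebesgue_on_Y \<Y>) (\<lambda>y. cond_density f g (\<theta>, \<gamma>) x y * indicator ({..<g x u} \<inter> \<Y>) y)"
      by (intro integrable_real_mult_indicator cond_density_integrable[OF x \<theta>] below_measurable_Y)
    have nn: "0 \<le> f y x (\<theta>, \<gamma>) * indicator {g x \<theta>..<g x u} y" if "y \<in> \<Y>" for y
      using f_pos[OF x that \<theta>] by (simp add: less_imp_le)
    have Jx: "J x = (\<integral>y. cond_density f g (\<theta>, \<gamma>) x y * indicator ({..<g x u} \<inter> \<Y>) y \<partial>lebesgue_on_Y \<Y>)"
      unfolding J_def by (intro Bochner_Integration.integral_cong refl eq[symmetric]) (simp add: space_lebesgue_on_Y)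
    have "(\<integral>\<^sup>+y. ennreal (pmf pX x) * ennreal (cond_density f g (\<theta>, \<gamma>) x y) * indicator B (y, x) \<partial>lebesgue_on_Y \<Y>)
       = (\<integral>\<^sup>+y. ennreal (pmf pX x) * ennreal (cond_density f g (\<theta>, \<gamma>) x y * indicator ({..<g x u} \<inter> \<Y>) y) \<partial>lebesgue_on_Y \<Y>)"
      using x by (intro nn_integral_cong) (auto simp: B_def indicator_def space_lebesgue_on_Y)
    also have "\<dots> = ennreal (pmf pX x) * (\<integral>\<^sup>+y. ennreal (cond_density f g (\<theta>, \<gamma>) x y * indicator ({..<g x u} \<inter> \<Y>) y) \<partial>lebesgue_on_Y \<Y>)"
      by (intro nn_integral_cmult) measurable
    also have "(\<integral>\<^sup>+y. ennreal (cond_density f g (\<theta>, \<gamma>) x y * indicator ({..<g x u} \<inter> \<Y>) y) \<partial>lebesgue_on_Y \<Y>) = ennreal (J x)"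
      unfolding Jx using nn eq by (intro nn_integral_eq_integral[OF int] AE_I2) (auto simp: space_lebesgue_on_Y)
    finally show "(\<integral>\<^sup>+y. ennreal (pmf pX x) * ennreal (cond_density f g (\<theta>, \<gamma>) x y) * indicator B (y, x) \<partial>lebesgue_on_Y \<Y>)
     = ennreal (pmf pX x * J x)" by (simp add: ennreal_mult')
    show "0 \<le> J x" unfolding J_def
      using nn by (intro Bochner_Integration.integral_nonneg_AE AE_I2) (auto simp: space_lebesgue_on_Y)
  qed
  have "emeasure (obs_law \<Y> pX f g (\<theta>, \<gamma>)) B = (\<integral>\<^sup>+z. ennreal (obs_density \<theta> z) * indicator B z \<partial>dom_measure \<Y> pX)"
    by (simp add: obs_law_eq_density emeasure_density)
  also have "\<dots> = (\<Sum>x\<in>set_pmf pX. ennreal (pmf pX x * J x))"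
    by (subst nn_integral_obs_density[OF \<theta>]) (auto simp: J)
  also have "\<dots> = ennreal (\<Sum>x\<in>set_pmf pX. pmf pX x * J x)" using J0 by (intro sum_ennreal) auto
  finally show ?thesis
    unfolding crossing_prob_def B_def[symmetric] J_def[symmetric] measure_def
    using J0 by (simp add: sum_nonneg)
qed

lemma eventually_in_ball: "\<forall>\<^sub>F n in sequentially. \<theta>0 + h / real n \<in> ball \<theta>0 d"
proof -
  have "(\<lambda>n. \<theta>0 + h / real n) \<longlonglongrightarrow> \<theta>0 + 0"
    by (intro tendsto_add tendsto_const lim_const_over_n)
  then have "(\<lambda>n. \<theta>0 + h / real n) \<longlonglongrightarrow> \<theta>0" by simp
  from topological_tendstoD[OF this open_ball] d show ?thesis by auto
qed

lemma g_seq_tendsto: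
  assumes x: "x \<in> set_pmf pX"
  shows "(\<lambda>n. g x (\<theta>0 + t / real n)) \<longlonglongrightarrow> g x \<theta>0"
proof -
  have "isCont (g x) \<theta>0" using g_deriv[OF x] by (rule DERIV_isCont)
  moreover have "(\<lambda>n. \<theta>0 + t / real n) \<longlonglongrightarrow> \<theta>0 + 0" by (intro tendsto_add tendsto_const lim_const_over_n)
  ultimately show ?thesis by (intro isCont_tendsto_compose[of \<theta>0 "g x"]) auto
qed

lemma f_lipschitz:
  assumes "x \<in> set_pmf pX" "y \<in> \<Y>" "\<theta> \<in> ball \<theta>0 d"
  shows "\<bar>f y x (\<theta>, \<gamma>) - f y x (\<theta>0, \<gamma>)\<bar> \<le> C * \<bar>\<theta> - \<theta>0\<bar>"
proof -
  have "norm (f y x (\<theta>, \<gamma>) - f y x (\<theta>0, \<gamma>)) \<le> C * norm (\<theta> - \<theta>0)"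
    by (rule field_differentiable_bound[where S = "ball \<theta>0 d" and f' = "D y x"])
       (use assms d f_deriv D_bound in \<open>auto intro: has_field_derivative_at_within\<close>)
  then show ?thesis by simp
qed

lemma f_seq_near_boundary:
  assumes x: "x \<in> set_pmf pX" and \<eta>: "0 < \<eta>"
  shows "\<exists>\<delta>>0. \<forall>\<^sub>F n in sequentially. \<forall>y\<in>\<Y>. \<bar>y - g x \<theta>0\<bar> < \<delta> \<longrightarrow>
     \<bar>f y x (\<theta>0 + h / real n, \<gamma>) - f (g x \<theta>0) x (\<theta>0, \<gamma>)\<bar> \<le> \<eta>"
proof -
  have "g x \<theta>0 \<in> \<Y>" using bnd_int[OF x] interior_subset by blast
  then obtain \<delta> where \<delta>: "0 < \<delta>" "\<And>y. y \<in> \<Y> \<Longrightarrow> \<bar>y - g x \<theta>0\<bar> < \<delta> \<Longrightarrow>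
      \<bar>f y x (\<theta>0, \<gamma>) - f (g x \<theta>0) x (\<theta>0, \<gamma>)\<bar> < \<eta> / 2"
    using f_cont[OF x] \<eta> unfolding continuous_on_iff dist_real_def
    by (metis half_gt_zero)
  have "(\<lambda>n. h / real n) \<longlonglongrightarrow> 0" by (rule lim_const_over_n)
  then have "(\<lambda>n. C * \<bar>h / real n\<bar>) \<longlonglongrightarrow> 0"
    by (intro tendsto_mult_right_zero tendsto_rabs_zero)
  then have "\<forall>\<^sub>F n in sequentially. C * \<bar>h / real n\<bar> < \<eta> / 2"
    by (rule order_tendstoD) (use \<eta> in simp)
  then have "\<forall>\<^sub>F n in sequentially. \<forall>y\<in>\<Y>. \<bar>y - g x \<theta>0\<bar> < \<delta> \<longrightarrow>
     \<bar>f y x (\<theta>0 + h / real n, \<gamma>) - f (g x \<theta>0) x (\<theta>0, \<gamma>)\<bar> \<le> \<eta>"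
    using eventually_in_ball[of h]
  proof eventually_elim
    case (elim n)
    show ?case
    proof (intro ballI impI)
      fix y assume y: "y \<in> \<Y>" "\<bar>y - g x \<theta>0\<bar> < \<delta>"
      have "\<bar>f y x (\<theta>0 + h / real n, \<gamma>) - f y x (\<theta>0, \<gamma>)\<bar> \<le> C * \<bar>h / real n\<bar>"
        using f_lipschitz[OF x y(1) elim(2)] by simp
      then show "\<bar>f y x (\<theta>0 + h / real n, \<gamma>) - f (g x \<theta>0) x (\<theta>0, \<gamma>)\<bar> \<le> \<eta>"
        using \<delta>(2)[OF y] elim(1) by linarith
    qed
  qed
  with \<delta> show ?thesis by blast
qed

text \<open>
  Given \<open>X = x\<close>, an observation lies below the curve at \<open>\<theta>0 + t/n\<close> if it falls between the curves at
  \<open>\<theta>0 + h/n\<close> and \<open>\<theta>0 + t/n\<close>. These are \<open>(t - h) G x / n\<close> apart up to \<open>o(1/n)\<close>, and the density there is close to its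
  value at the limiting boundary point.
\<close>

lemma crossing_prob_limit:
  "(\<lambda>n. real n * crossing_prob (\<theta>0 + h / real n) (\<theta>0 + t / real n)) \<longlonglongrightarrow> rate * max 0 (t - h)"
proof -
  define J where "J x n = (\<integral>y. f y x (\<theta>0 + h / real n, \<gamma>)
      * indicator {g x (\<theta>0 + h / real n)..<g x (\<theta>0 + t / real n)} y \<partial>lebesgue_on_Y \<Y>)" for x n
  have J: "(\<lambda>n. real n * J x n) \<longlonglongrightarrow> f (g x \<theta>0) x (\<theta>0, \<gamma>) * (max 0 (t - h) * G x)"
    if x: "x \<in> set_pmf pX" for x
  proof (cases "t \<le> h")
    case True
    have "\<forall>\<^sub>F n in sequentially. 0 = real n * J x n"
      using eventually_in_ball[of h] eventually_in_ball[of t]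
    proof eventually_elim
      case (elim n)
      have "g x (\<theta>0 + t / real n) \<le> g x (\<theta>0 + h / real n)"
        using elim True by (intro mono_onD[OF g_mono[OF x]]) (auto intro!: divide_right_mono)
      then show ?case by (simp add: J_def)
    qed
    then have "(\<lambda>n. real n * J x n) \<longlonglongrightarrow> 0" by (rule Lim_transform_eventually[OF tendsto_const])
    then show ?thesis using True by (simp add: max_def)
  next
    case False
    have "(\<lambda>n. real n * J x n) \<longlonglongrightarrow> f (g x \<theta>0) x (\<theta>0, \<gamma>) * (t * G x - h * G x)"
      unfolding J_def
    proof (rule tendsto_scaled_interval_integral[OF Y bnd_int[OF x] _ g_seq_tendsto[OF x] g_seq_tendsto[OF x]])
      show "\<forall>\<^sub>F n in sequentially. (\<lambda>y. f y x (\<theta>0 + h / real n, \<gamma>)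
          * indicator {g x (\<theta>0 + h / real n)..<g x (\<theta>0 + t / real n)} y) \<in> borel_measurable (lebesgue_on_Y \<Y>)"
        using eventually_in_ball[of h]
      proof eventually_elim
        case (elim n)
        note [measurable] = cond_meas[OF x elim] below_measurable_Y
        have "(\<lambda>y. cond_density f g (\<theta>0 + h / real n, \<gamma>) x y * indicator ({..<g x (\<theta>0 + t / real n)} \<inter> \<Y>) y)
           \<in> borel_measurable (lebesgue_on_Y \<Y>)" by measurable
        then show ?case
          by (subst (asm) measurable_cong[where g = "\<lambda>y. f y x (\<theta>0 + h / real n, \<gamma>)
          * indicator {g x (\<theta>0 + h / real n)..<g x (\<theta>0 + t / real n)} y"])
             (auto simp: cond_density_def indicator_def space_lebesgue_on_Y)
      qed
      show "\<forall>\<^sub>F n in sequentially. g x (\<theta>0 + h / real n) \<le> g x (\<theta>0 + t / real n)"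
        using eventually_in_ball[of h] eventually_in_ball[of t]
        by eventually_elim (use False in \<open>auto intro!: mono_onD[OF g_mono[OF x]] divide_right_mono\<close>)
      have "(\<lambda>n. real n * (g x (\<theta>0 + t / real n) - g x \<theta>0) - real n * (g x (\<theta>0 + h / real n) - g x \<theta>0))
         \<longlonglongrightarrow> t * G x - h * G x"
        by (intro tendsto_diff difference_quotient_sequence g_deriv x)
      then show "(\<lambda>n. real n * (g x (\<theta>0 + t / real n) - g x (\<theta>0 + h / real n))) \<longlonglongrightarrow> t * G x - h * G x"
        by (simp add: algebra_simps)
    qed (rule f_seq_near_boundary[OF x])
    then show ?thesis using False by (simp add: max_def algebra_simps)
  qed
  have "(\<lambda>n. \<Sum>x\<in>set_pmf pX. pmf pX x * (real n * J x n))
      \<longlonglongrightarrow> (\<Sum>x\<in>set_pmf pX. pmf pX x * (f (g x \<theta>0) x (\<theta>0, \<gamma>) * (max 0 (t - h) * G x)))"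
    by (intro tendsto_sum tendsto_mult tendsto_const J)
  also have "(\<Sum>x\<in>set_pmf pX. pmf pX x * (f (g x \<theta>0) x (\<theta>0, \<gamma>) * (max 0 (t - h) * G x))) = rate * max 0 (t - h)"
    by (simp add: rate_def sum_distrib_left sum_distrib_right mult_ac)
  finally have lim: "(\<lambda>n. \<Sum>x\<in>set_pmf pX. pmf pX x * (real n * J x n)) \<longlonglongrightarrow> rate * max 0 (t - h)" .
  have "\<forall>\<^sub>F n in sequentially. (\<Sum>x\<in>set_pmf pX. pmf pX x * (real n * J x n))
      = real n * crossing_prob (\<theta>0 + h / real n) (\<theta>0 + t / real n)"
    using eventually_in_ball[of h]
    by eventually_elim (simp add: crossing_prob_eq J_def sum_distrib_left mult_ac)
  with lim show ?thesis by (rule Lim_transform_eventually)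
qed

lemma prob_some_crossing:
  assumes \<theta>: "\<theta>0 + h / real n \<in> ball \<theta>0 d"
  shows "{\<omega> \<in> space (P h n). \<exists>i<n. fst (\<omega> i) < g (snd (\<omega> i)) u} \<in> sets (P h n)"
    and "measure (P h n) {\<omega> \<in> space (P h n). \<exists>i<n. fst (\<omega> i) < g (snd (\<omega> i)) u}
      = 1 - (1 - crossing_prob (\<theta>0 + h / real n) u) ^ n"
proof -
  define M where "M = density (dom_measure \<Y> pX) (\<lambda>z. ennreal (obs_density (\<theta>0 + h / real n) z))"
  interpret M: prob_space M unfolding M_def by (rule prob_space_obs[OF \<theta>])
  interpret PM: finite_product_prob_space "\<lambda>_. M" "{..<n}"
    by standard auto
  have P: "P h n = PiM {..<n} (\<lambda>_. M)" by (simp add: local_law_eq M_def)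
  have spM: "space M = \<Y> \<times> set_pmf pX" by (simp add: M_def space_dom_measure)
  define B where "B = {z \<in> \<Y> \<times> set_pmf pX. fst z < g (snd z) u}"
  have B: "B \<in> sets M" unfolding B_def M_def using below_measurable by simp
  have A: "(\<Pi>\<^sub>E i\<in>{..<n}. space M - B) \<in> sets (P h n)"
    unfolding P using B by (intro sets_PiM_I_finite) auto
  have eq: "{\<omega> \<in> space (P h n). \<exists>i<n. fst (\<omega> i) < g (snd (\<omega> i)) u} = space (P h n) - (\<Pi>\<^sub>E i\<in>{..<n}. space M - B)"
  proof -
    have "(\<exists>i<n. fst (\<omega> i) < g (snd (\<omega> i)) u) \<longleftrightarrow> \<omega> \<notin> (\<Pi>\<^sub>E i\<in>{..<n}. space M - B)"
      if "\<omega> \<in> space (P h n)" for \<omega>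
    proof -
      have "\<omega> \<in> (\<Pi>\<^sub>E i\<in>{..<n}. space M)" using that by (simp add: P space_PiM)
      then have "\<omega> \<in> (\<Pi>\<^sub>E i\<in>{..<n}. space M - B) \<longleftrightarrow> (\<forall>i<n. \<omega> i \<notin> B)" "\<forall>i<n. \<omega> i \<in> \<Y> \<times> set_pmf pX"
        unfolding spM by (auto simp: PiE_iff)
      then show ?thesis by (auto simp: B_def)
    qed
    then show ?thesis by blast
  qed
  show "{\<omega> \<in> space (P h n). \<exists>i<n. fst (\<omega> i) < g (snd (\<omega> i)) u} \<in> sets (P h n)"
    unfolding eq using A by auto
  have "measure (P h n) (\<Pi>\<^sub>E i\<in>{..<n}. space M - B) = (1 - measure M B) ^ n"
    unfolding P using B by (subst PM.prob_times) (auto simp: M.prob_compl)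
  moreover have "measure M B = crossing_prob (\<theta>0 + h / real n) u"
    by (simp add: crossing_prob_def M_def obs_law_eq_density B_def)
  ultimately show "measure (P h n) {\<omega> \<in> space (P h n). \<exists>i<n. fst (\<omega> i) < g (snd (\<omega> i)) u}
      = 1 - (1 - crossing_prob (\<theta>0 + h / real n) u) ^ n"
    unfolding eq using A P by (simp add: PM.P.prob_compl)
qed

text \<open>
  The number of observations below the curve is asymptotically Poisson; this is its probability of being positive.
\<close>

lemma some_crossing_limit:
  "(\<lambda>n. measure (P h n) {\<omega> \<in> space (P h n). \<exists>i<n. fst (\<omega> i) < g (snd (\<omega> i)) (\<theta>0 + t / real n)})
     \<longlonglongrightarrow> 1 - exp (- (rate * max 0 (t - h)))"
proof -
  have "(\<lambda>n. 1 - (1 - crossing_prob (\<theta>0 + h / real n) (\<theta>0 + t / real n)) ^ n) \<longlonglongrightarrow> 1 - exp (- (rate * max 0 (t - h)))"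
    by (intro tendsto_diff tendsto_const power_one_minus_tendsto_exp crossing_prob_limit) (simp add: crossing_prob_def)
  moreover have "\<forall>\<^sub>F n in sequentially. 1 - (1 - crossing_prob (\<theta>0 + h / real n) (\<theta>0 + t / real n)) ^ n
      = measure (P h n) {\<omega> \<in> space (P h n). \<exists>i<n. fst (\<omega> i) < g (snd (\<omega> i)) (\<theta>0 + t / real n)}"
    using eventually_in_ball[of h] by eventually_elim (simp add: prob_some_crossing(2))
  ultimately show ?thesis by (rule Lim_transform_eventually)
qed

lemma prob_space_local_law:
  assumes \<theta>: "\<theta>0 + h / real n \<in> ball \<theta>0 d"
  shows "prob_space (P h n)"
  unfolding local_law_eq using prob_space_obs[OF \<theta>] by (intro prob_space_PiM) auto

section \<open>The power envelope\<close>

text \<open>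
  The mean value theorem for \<open>\<surd>f\<close>, whose derivative is \<open>D / (2 \<surd>f)\<close>. As the boundary increases in \<open>\<theta>\<close>, a point
  above the curve at \<open>\<theta>0\<close> is above all the curves at smaller parameters. For \<open>\<theta> < \<theta>0\<close> the indicator in the
  integrable envelope is therefore \<open>1\<close> at the intermediate parameter.
\<close>

lemma sqrt_density_increment:
  assumes x: "x \<in> set_pmf pX" and y: "y \<in> \<Y>" and \<theta>: "\<theta> \<in> ball \<theta>0 d" "\<theta> < \<theta>0"
    and above: "g x \<theta>0 \<le> y"
  shows "ennreal ((sqrt (f y x (\<theta>, \<gamma>)) - sqrt (f y x (\<theta>0, \<gamma>)))\<^sup>2 / (\<theta>0 - \<theta>)\<^sup>2)
    \<le> (SUP \<theta>\<in>ball \<theta>0 d. ennreal ((D y x \<theta>)\<^sup>2 / f y x (\<theta>, \<gamma>) * indicator {g x \<theta>..} y))"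
proof -
  have in_ball: "\<tau> \<in> ball \<theta>0 d" if "\<theta> \<le> \<tau>" "\<tau> \<le> \<theta>0" for \<tau>
    using that \<theta> by (auto simp: dist_real_def)
  have "\<exists>\<tau>>\<theta>. \<tau> < \<theta>0 \<and> sqrt (f y x (\<theta>0, \<gamma>)) - sqrt (f y x (\<theta>, \<gamma>))
      = (\<theta>0 - \<theta>) * (D y x \<tau> * (inverse (sqrt (f y x (\<tau>, \<gamma>))) / 2))"
    using \<theta>(2)
  proof (rule MVT2)
    fix \<tau> assume "\<theta> \<le> \<tau>" "\<tau> \<le> \<theta>0"
    then have "\<tau> \<in> ball \<theta>0 d" by (rule in_ball)
    from DERIV_chain2[OF DERIV_real_sqrt[OF f_pos[OF x y this]] f_deriv[OF x y this]]
    show "((\<lambda>\<theta>. sqrt (f y x (\<theta>, \<gamma>))) has_real_derivative D y x \<tau> * (inverse (sqrt (f y x (\<tau>, \<gamma>))) / 2)) (at \<tau>)"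
      by (simp add: mult.commute)
  qed
  then obtain \<tau> where \<tau>: "\<theta> < \<tau>" "\<tau> < \<theta>0" and eq: "sqrt (f y x (\<theta>0, \<gamma>)) - sqrt (f y x (\<theta>, \<gamma>))
      = (\<theta>0 - \<theta>) * (D y x \<tau> * (inverse (sqrt (f y x (\<tau>, \<gamma>))) / 2))" by blast
  have \<tau>b: "\<tau> \<in> ball \<theta>0 d" using in_ball \<tau> by auto
  have "g x \<tau> \<le> g x \<theta>0" using \<tau> \<tau>b d by (intro mono_onD[OF g_mono[OF x]]) auto
  then have ind: "indicator {g x \<tau>..} y = (1::real)" using above by simp
  have f0: "0 < f y x (\<tau>, \<gamma>)" by (rule f_pos[OF x y \<tau>b])
  have "(sqrt (f y x (\<theta>, \<gamma>)) - sqrt (f y x (\<theta>0, \<gamma>)))\<^sup>2 / (\<theta>0 - \<theta>)\<^sup>2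
      = (sqrt (f y x (\<theta>0, \<gamma>)) - sqrt (f y x (\<theta>, \<gamma>)))\<^sup>2 / (\<theta>0 - \<theta>)\<^sup>2"
    by (simp add: power2_commute)
  also have "\<dots> = (D y x \<tau>)\<^sup>2 / f y x (\<tau>, \<gamma>) / 4"
  proof -
    define w where "w = sqrt (f y x (\<tau>, \<gamma>))"
    have w: "w \<noteq> 0" "f y x (\<tau>, \<gamma>) = w\<^sup>2" using f0 by (auto simp: w_def)
    have e: "\<theta>0 - \<theta> \<noteq> 0" using \<theta>(2) by simp
    have "(e * (u * (inverse w / 2)))\<^sup>2 / e\<^sup>2 = u\<^sup>2 / w\<^sup>2 / 4" if "e \<noteq> 0" for e u :: real
      using w(1) that by (simp add: power2_eq_square field_simps)
    from this[OF e, of "D y x \<tau>"] show ?thesis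
      unfolding eq w_def[symmetric] unfolding w(2) .
  qed
  also have "\<dots> \<le> (D y x \<tau>)\<^sup>2 / f y x (\<tau>, \<gamma>) * indicator {g x \<tau>..} y"
    using f0 by (simp add: ind field_simps)
  finally have "ennreal ((sqrt (f y x (\<theta>, \<gamma>)) - sqrt (f y x (\<theta>0, \<gamma>)))\<^sup>2 / (\<theta>0 - \<theta>)\<^sup>2)
     \<le> ennreal ((D y x \<tau>)\<^sup>2 / f y x (\<tau>, \<gamma>) * indicator {g x \<tau>..} y)" by (rule ennreal_leI)
  also have "\<dots> \<le> (SUP \<theta>\<in>ball \<theta>0 d. ennreal ((D y x \<theta>)\<^sup>2 / f y x (\<theta>, \<gamma>) * indicator {g x \<theta>..} y))"
    using \<tau>b by (rule SUP_upper)
  finally show ?thesis .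
qed

text \<open>
  The density under \<open>\<theta>\<close>, cut down to the support of the null model. For \<open>\<theta> < \<theta>0\<close> this discards exactly the observations that
  refute the null hypothesis with certainty.
\<close>

definition truncated_density :: "real \<Rightarrow> real \<times> (real^'dx) \<Rightarrow> real" where
  "truncated_density \<theta> z = obs_density \<theta> z * indicator {z \<in> \<Y> \<times> set_pmf pX. g (snd z) \<theta>0 \<le> fst z} z"

lemma truncated_density_measurable: "\<theta> \<in> ball \<theta>0 d \<Longrightarrow> truncated_density \<theta> \<in> borel_measurable (dom_measure \<Y> pX)"
proof -
  assume \<theta>: "\<theta> \<in> ball \<theta>0 d"
  have "{z \<in> \<Y> \<times> set_pmf pX. g (snd z) \<theta>0 \<le> fst z}
     = space (dom_measure \<Y> pX) - {z \<in> \<Y> \<times> set_pmf pX. fst z < g (snd z) \<theta>0}"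
    by (auto simp: space_dom_measure)
  then have [measurable]: "{z \<in> \<Y> \<times> set_pmf pX. g (snd z) \<theta>0 \<le> fst z} \<in> sets (dom_measure \<Y> pX)"
    using below_measurable[of "\<lambda>x. g x \<theta>0"] by auto
  note [measurable] = obs_density_measurable[OF \<theta>]
  show ?thesis unfolding truncated_density_def by measurable
qed

lemma truncated_density_mass:
  assumes \<theta>: "\<theta> \<in> ball \<theta>0 d"
  shows "1 - (\<integral>z. truncated_density \<theta> z \<partial>dom_measure \<Y> pX) = crossing_prob \<theta> \<theta>0"
proof -
  define B where "B = {z \<in> \<Y> \<times> set_pmf pX. fst z < g (snd z) \<theta>0}"
  have B[measurable]: "B \<in> sets (dom_measure \<Y> pX)" unfolding B_def by (rule below_measurable)
  note [measurable] = obs_density_measurable[OF \<theta>] truncated_density_measurable[OF \<theta>]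
  note iq = prob_density_integral[OF obs_density_measurable[OF \<theta>] obs_density_nonneg prob_space_obs[OF \<theta>]]
  have iB: "integrable (dom_measure \<Y> pX) (\<lambda>z. obs_density \<theta> z * indicator B z)"
    using iq(1) B by (rule integrable_real_mult_indicator[rotated])
  have "(\<integral>z. truncated_density \<theta> z \<partial>dom_measure \<Y> pX) = (\<integral>z. obs_density \<theta> z - obs_density \<theta> z * indicator B z \<partial>dom_measure \<Y> pX)"
    by (intro Bochner_Integration.integral_cong refl)
       (auto simp: truncated_density_def B_def space_dom_measure indicator_def)
  also have "\<dots> = 1 - (\<integral>z. obs_density \<theta> z * indicator B z \<partial>dom_measure \<Y> pX)"
    using iq iB by simp
  also have "(\<integral>z. obs_density \<theta> z * indicator B z \<partial>dom_measure \<Y> pX)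
     = (\<integral>z. indicator B z \<partial>density (dom_measure \<Y> pX) (\<lambda>z. ennreal (obs_density \<theta> z)))"
    using obs_density_nonneg by (subst integral_real_density) auto
  also have "\<dots> = measure (density (dom_measure \<Y> pX) (\<lambda>z. ennreal (obs_density \<theta> z))) B"
    using sets.sets_into_space[OF B] by (simp add: Int_absorb2)
  also have "\<dots> = crossing_prob \<theta> \<theta>0" by (simp add: crossing_prob_def obs_law_eq_density B_def)
  finally show ?thesis by simp
qed

text \<open>
  On the common support the model is smooth, so the squared Hellinger distance is quadratic in the parameter
  increment. The supremum in the envelope need not be measurable, which is harmless: the lower integral is monotone,
  and the constant factor is moved to the measurable side.
\<close>

lemma hellinger_bound:
  "\<exists>K. \<forall>\<theta>\<in>ball \<theta>0 d. \<theta> < \<theta>0 \<longrightarrow>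
     (\<integral>z. (sqrt (truncated_density \<theta> z) - sqrt (obs_density \<theta>0 z))\<^sup>2 \<partial>dom_measure \<Y> pX) \<le> (\<theta>0 - \<theta>)\<^sup>2 * K"
proof -
  define K where "K = (\<Sum>x\<in>set_pmf pX. \<integral>\<^sup>+ y. (SUP \<theta>\<in>ball \<theta>0 d.
      ennreal ((D y x \<theta>)\<^sup>2 / f y x (\<theta>, \<gamma>) * indicator {g x \<theta>..} y)) \<partial>lebesgue_on_Y \<Y>)"
  have Kfin: "K < \<infinity>" unfolding K_def using info fin by (simp add: less_top)
  have \<theta>0: "\<theta>0 \<in> ball \<theta>0 d" using d by simp
  show ?thesis
  proof (intro exI[of _ "enn2real K"] ballI impI)
    fix \<theta> assume \<theta>: "\<theta> \<in> ball \<theta>0 d" "\<theta> < \<theta>0"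
    note [measurable] = obs_density_measurable[OF \<theta>0] truncated_density_measurable[OF \<theta>(1)]
    define H where "H z = (sqrt (truncated_density \<theta> z) - sqrt (obs_density \<theta>0 z))\<^sup>2 / (\<theta>0 - \<theta>)\<^sup>2" for z
    have [measurable]: "H \<in> borel_measurable (dom_measure \<Y> pX)" unfolding H_def by measurable
    have "(\<integral>\<^sup>+z. ennreal (H z) \<partial>dom_measure \<Y> pX) = (\<Sum>x\<in>set_pmf pX. \<integral>\<^sup>+y. ennreal (H (y, x)) \<partial>lebesgue_on_Y \<Y>)"
      using Y fin by (intro nn_integral_dom_measure) auto
    also have "\<dots> \<le> K"
      unfolding K_def
    proof (intro sum_mono nn_integral_mono)
      fix x y assume x: "x \<in> set_pmf pX" and "y \<in> space (lebesgue_on_Y \<Y>)"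
      then have y: "y \<in> \<Y>" by (simp add: space_lebesgue_on_Y)
      show "ennreal (H (y, x)) \<le> (SUP \<theta>\<in>ball \<theta>0 d. ennreal ((D y x \<theta>)\<^sup>2 / f y x (\<theta>, \<gamma>) * indicator {g x \<theta>..} y))"
      proof (cases "g x \<theta>0 \<le> y")
        case True
        have "g x \<theta> \<le> g x \<theta>0" using \<theta> d by (intro mono_onD[OF g_mono[OF x]]) auto
        then have "H (y, x) = (sqrt (pmf pX x) * (sqrt (f y x (\<theta>, \<gamma>)) - sqrt (f y x (\<theta>0, \<gamma>))))\<^sup>2 / (\<theta>0 - \<theta>)\<^sup>2"
          using True x y by (simp add: H_def truncated_density_def obs_density_eq[OF x y \<theta>(1)] obs_density_eq[OF x y \<theta>0] real_sqrt_mult algebra_simps)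
        also have "\<dots> = pmf pX x * ((sqrt (f y x (\<theta>, \<gamma>)) - sqrt (f y x (\<theta>0, \<gamma>)))\<^sup>2 / (\<theta>0 - \<theta>)\<^sup>2)"
          by (simp add: power_mult_distrib)
        also have "\<dots> \<le> (sqrt (f y x (\<theta>, \<gamma>)) - sqrt (f y x (\<theta>0, \<gamma>)))\<^sup>2 / (\<theta>0 - \<theta>)\<^sup>2"
          by (intro mult_left_le_one_le) (auto simp: pmf_le_1)
        finally show ?thesis
          by (intro order_trans[OF ennreal_leI sqrt_density_increment[OF x y \<theta> True]])
      next
        case False
        then have "H (y, x) = 0" using x y by (simp add: H_def truncated_density_def obs_density_eq[OF x y \<theta>0])
        then show ?thesis by simp
      qed
    qed
    finally have HK: "(\<integral>\<^sup>+z. ennreal (H z) \<partial>dom_measure \<Y> pX) \<le> K" .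
    have "(\<integral>z. H z \<partial>dom_measure \<Y> pX) = enn2real (\<integral>\<^sup>+z. ennreal (H z) \<partial>dom_measure \<Y> pX)"
      by (intro integral_eq_nn_integral) (auto simp: H_def)
    also have "\<dots> \<le> enn2real K" using HK Kfin by (intro enn2real_mono) auto
    finally have "(\<integral>z. H z \<partial>dom_measure \<Y> pX) \<le> enn2real K" .
    moreover have "(\<integral>z. (sqrt (truncated_density \<theta> z) - sqrt (obs_density \<theta>0 z))\<^sup>2 \<partial>dom_measure \<Y> pX)
       = (\<theta>0 - \<theta>)\<^sup>2 * (\<integral>z. H z \<partial>dom_measure \<Y> pX)"
      using \<theta>(2) by (simp add: H_def)
    ultimately show "(\<integral>z. (sqrt (truncated_density \<theta> z) - sqrt (obs_density \<theta>0 z))\<^sup>2 \<partial>dom_measure \<Y> pX) \<le> (\<theta>0 - \<theta>)\<^sup>2 * enn2real K"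
      by (simp add: mult_left_mono)
  qed
qed

lemma hellinger_limit:
  assumes h: "h < 0"
  shows "(\<lambda>n. real n * (\<integral>z. (sqrt (truncated_density (\<theta>0 + h / real n) z) - sqrt (obs_density \<theta>0 z))\<^sup>2 \<partial>dom_measure \<Y> pX)) \<longlonglongrightarrow> 0"
proof -
  obtain K where K: "\<And>\<theta>. \<theta> \<in> ball \<theta>0 d \<Longrightarrow> \<theta> < \<theta>0 \<Longrightarrow>
     (\<integral>z. (sqrt (truncated_density \<theta> z) - sqrt (obs_density \<theta>0 z))\<^sup>2 \<partial>dom_measure \<Y> pX) \<le> (\<theta>0 - \<theta>)\<^sup>2 * K"
    using hellinger_bound by blast
  show ?thesis
  proof (rule tendsto_sandwich[OF _ _ tendsto_const lim_const_over_n])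
    show "\<forall>\<^sub>F n in sequentially. real n * (\<integral>z. (sqrt (truncated_density (\<theta>0 + h / real n) z) - sqrt (obs_density \<theta>0 z))\<^sup>2 \<partial>dom_measure \<Y> pX) \<le> (h\<^sup>2 * K) / of_nat n"
      using eventually_in_ball[of h] eventually_gt_at_top[of 0]
    proof eventually_elim
      case (elim n)
      have "real n * (\<integral>z. (sqrt (truncated_density (\<theta>0 + h / real n) z) - sqrt (obs_density \<theta>0 z))\<^sup>2 \<partial>dom_measure \<Y> pX)
         \<le> real n * ((\<theta>0 - (\<theta>0 + h / real n))\<^sup>2 * K)"
        using K[OF elim(1)] h elim(2) by (intro mult_left_mono) (auto simp: divide_neg_pos)
      also have "\<dots> = h\<^sup>2 * K / real n" using elim(2) by (simp add: power2_eq_square field_simps)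
      finally show ?case .
    qed
    show "\<forall>\<^sub>F n in sequentially. 0 \<le> real n * (\<integral>z. (sqrt (truncated_density (\<theta>0 + h / real n) z) - sqrt (obs_density \<theta>0 z))\<^sup>2 \<partial>dom_measure \<Y> pX)"
      by (intro always_eventually allI mult_nonneg_nonneg Bochner_Integration.integral_nonneg_AE) auto
  qed
qed

text \<open>
  An observation falls below the null boundary with probability about \<open>- h rate / n\<close>, whereas the remaining part of
  the model has squared Hellinger distance \<open>O(1/n\<^sup>2)\<close> from the null. The general envelope applies with
  \<open>a = - h rate\<close>.
\<close>

theorem power_envelope:
  assumes h: "h < 0"
    and test: "\<And>n. is_test (sample_space \<Y> pX n) (\<psi> n)"
    and level: "limsup (\<lambda>n. ereal (\<integral>\<omega>. \<psi> n \<omega> \<partial>P 0 n)) \<le> ereal \<alpha>"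
  shows "limsup (\<lambda>n. ereal (\<integral>\<omega>. \<psi> n \<omega> \<partial>P h n)) \<le> ereal (1 - exp (rate * h) * (1 - \<alpha>))"
proof -
  have \<theta>0: "\<theta>0 \<in> ball \<theta>0 d" using d by simp
  have mass: "(\<lambda>n. real n * (1 - (\<integral>z. truncated_density (\<theta>0 + h / real n) z \<partial>dom_measure \<Y> pX))) \<longlonglongrightarrow> - (rate * h)"
  proof (rule Lim_transform_eventually)
    show "(\<lambda>n. real n * crossing_prob (\<theta>0 + h / real n) \<theta>0) \<longlonglongrightarrow> - (rate * h)"
      using crossing_prob_limit[of h 0] h by simp
    show "\<forall>\<^sub>F n in sequentially. real n * crossing_prob (\<theta>0 + h / real n) \<theta>0
        = real n * (1 - (\<integral>z. truncated_density (\<theta>0 + h / real n) z \<partial>dom_measure \<Y> pX))"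
      using eventually_in_ball[of h] by eventually_elim (simp add: truncated_density_mass)
  qed
  have "limsup (\<lambda>n. ereal (\<integral>\<omega>. \<psi> n \<omega> \<partial>P h n)) \<le> ereal (1 - exp (- (- (rate * h))) * (1 - \<alpha>))"
    unfolding local_law_eq
  proof (rule iid_power_envelope[OF _ _ _ _ _ _ _ _ _ mass hellinger_limit[OF h]])
    show "\<psi> n \<in> borel_measurable (PiM {..<n} (\<lambda>_. dom_measure \<Y> pX))" for n
      using test[of n] by (simp add: is_test_def sample_space_def)
    show "\<psi> n \<omega> \<in> {0..1}" if "\<omega> \<in> space (PiM {..<n} (\<lambda>_. dom_measure \<Y> pX))" for n \<omega>
      using test[of n] that by (auto simp: is_test_def sample_space_def)
    show "limsup (\<lambda>n. ereal (\<integral>\<omega>. \<psi> n \<omega> \<partial>PiM {..<n} (\<lambda>_. density (dom_measure \<Y> pX) (\<lambda>z. ennreal (obs_density \<theta>0 z))))) \<le> ereal \<alpha>"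
      using level by (simp add: local_law_eq)
    show "truncated_density \<theta> z \<le> obs_density \<theta> z" for \<theta> z using obs_density_nonneg by (auto simp: truncated_density_def indicator_def)
    show "0 \<le> truncated_density \<theta> z" for \<theta> z using obs_density_nonneg by (auto simp: truncated_density_def indicator_def)
    show "\<forall>\<^sub>F n in sequentially. obs_density (\<theta>0 + h / real n) \<in> borel_measurable (dom_measure \<Y> pX)"
      using eventually_in_ball[of h] by eventually_elim (rule obs_density_measurable)
    show "\<forall>\<^sub>F n in sequentially. truncated_density (\<theta>0 + h / real n) \<in> borel_measurable (dom_measure \<Y> pX)"
      using eventually_in_ball[of h] by eventually_elim (rule truncated_density_measurable)
    show "\<forall>\<^sub>F n in sequentially. prob_space (density (dom_measure \<Y> pX) (\<lambda>z. ennreal (obs_density (\<theta>0 + h / real n) z)))"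
      using eventually_in_ball[of h] by eventually_elim (rule prob_space_obs)
  qed (rule sigma_finite_dom_measure[OF Y fin] obs_density_measurable[OF \<theta>0] obs_density_nonneg prob_space_obs[OF \<theta>0])+
  then show ?thesis by simp
qed

end

section \<open>Limiting rejection probability of the one-sided test\<close>

lemma sqrt_n_consistent_imp_consistent:
  fixes T :: "nat \<Rightarrow> 'o \<Rightarrow> real"
  assumes cons: "sqrt_n_consistent S P T t" and sets: "\<And>n. sets (P n) = sets (S n)"
    and prob: "\<forall>\<^sub>F n in sequentially. prob_space (P n)" and \<epsilon>: "0 < \<epsilon>"
  shows "(\<lambda>n. measure (P n) {\<omega> \<in> space (P n). \<epsilon> < \<bar>T n \<omega> - t\<bar>}) \<longlonglongrightarrow> 0"
proof (rule tendstoI)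
  fix e :: real assume e: "0 < e"
  obtain M where M: "\<forall>\<^sub>F n in sequentially.
      measure (P n) {\<omega> \<in> space (P n). norm (sqrt (real n) *\<^sub>R (T n \<omega> - t)) > M} < e"
    using cons e by (auto simp: sqrt_n_consistent_def bounded_in_prob_def)
  have "\<forall>\<^sub>F n in sequentially. M / \<epsilon> < sqrt (real n)"
    using filterlim_compose[OF sqrt_at_top filterlim_real_sequentially] by (auto simp: filterlim_at_top_dense)
  with M prob show "\<forall>\<^sub>F n in sequentially. dist (measure (P n) {\<omega> \<in> space (P n). \<epsilon> < \<bar>T n \<omega> - t\<bar>}) 0 < e"
  proof eventually_elim
    case (elim n)
    interpret prob_space "P n" by fact
    have [measurable]: "T n \<in> borel_measurable (P n)"
      using cons by (simp add: sqrt_n_consistent_def measurable_cong_sets[OF sets refl])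
    have "measure (P n) {\<omega> \<in> space (P n). \<epsilon> < \<bar>T n \<omega> - t\<bar>}
       \<le> measure (P n) {\<omega> \<in> space (P n). norm (sqrt (real n) *\<^sub>R (T n \<omega> - t)) > M}"
    proof (rule finite_measure_mono)
      show "{\<omega> \<in> space (P n). \<epsilon> < \<bar>T n \<omega> - t\<bar>} \<subseteq> {\<omega> \<in> space (P n). norm (sqrt (real n) *\<^sub>R (T n \<omega> - t)) > M}"
      proof safe
        fix \<omega> assume dev: "\<epsilon> < \<bar>T n \<omega> - t\<bar>"
        have "M < sqrt (real n) * \<epsilon>" using elim(3) \<epsilon> by (simp add: divide_less_eq)
        also have "\<dots> \<le> sqrt (real n) * \<bar>T n \<omega> - t\<bar>" using dev by (intro mult_left_mono) auto
        finally show "M < norm (sqrt (real n) *\<^sub>R (T n \<omega> - t))" by (simp add: abs_mult)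
      qed
    qed measurable
    then show ?case using elim(1) by (simp add: dist_real_def)
  qed
qed

text \<open>
  The curves \<open>g x\<close> are continuous on \<open>\<Theta>\<close> only and nothing is known about \<open>g\<close> as a function of \<open>x\<close>. Measurability
  therefore treats the finitely many covariate values one by one and extends \<open>g x\<close> by \<open>0\<close> outside \<open>\<Theta>\<close>.
\<close>

lemma phi_plus_measurable:
  assumes fin: "finite (set_pmf pX)" and \<Theta>: "\<Theta> \<in> sets borel"
    and g: "\<And>x. x \<in> set_pmf pX \<Longrightarrow> continuous_on \<Theta> (g x)"
    and hhat: "hhat n \<in> borel_measurable (sample_space \<Y> pX n)"
    and junk: "\<And>i. i < n \<Longrightarrow> junk n i \<in> borel_measurable (sample_space \<Y> pX n)"
  shows "phi_plus g \<Theta> \<theta>0 junk hhat n \<in> borel_measurable (sample_space \<Y> pX n)"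
proof -
  let ?S = "sample_space \<Y> pX n"
  have "Measurable.pred ?S (\<lambda>\<omega>. \<exists>i\<in>{..<n}. fst (\<omega> i) < max (g (snd (\<omega> i)) \<theta>0)
      (plug_in_boundary g \<Theta> \<theta>0 (junk n i \<omega>) n (snd (\<omega> i)) (hhat n \<omega>)))"
  proof (intro pred_intros_finite)
    fix i assume i: "i \<in> {..<n}"
    have comp: "(\<lambda>\<omega>. \<omega> i) \<in> measurable ?S (lebesgue_on_Y \<Y> \<Otimes>\<^sub>M count_space (set_pmf pX))"
      using i unfolding sample_space_def dom_measure_def by (rule measurable_component_singleton)
    have "id \<in> borel_measurable (lebesgue_on_Y \<Y>)"
      unfolding lebesgue_on_Y_def by (intro measurable_restrict_space1) simp
    then have fst_m: "(\<lambda>\<omega>. fst (\<omega> i)) \<in> borel_measurable ?S"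
      using measurable_compose[OF measurable_compose[OF comp measurable_fst], of id borel] by simp
    have snd_m: "(\<lambda>\<omega>. snd (\<omega> i)) \<in> measurable ?S (count_space (set_pmf pX))"
      by (rule measurable_compose[OF comp measurable_snd])
    have "(\<lambda>\<omega>. (\<lambda>x \<omega>. fst (\<omega> i) < max (g x \<theta>0) (plug_in_boundary g \<Theta> \<theta>0 (junk n i \<omega>) n x (hhat n \<omega>))) (snd (\<omega> i)) \<omega>)
       \<in> measurable ?S (count_space UNIV)"
    proof (rule measurable_compose_countable'[OF _ snd_m countable_finite[OF fin]])
      fix x assume x: "x \<in> set_pmf pX"
      define g0 where "g0 t = (if t \<in> \<Theta> then g x t else 0)" for t
      have g0: "g0 \<in> borel_measurable borel"
        unfolding g0_def[abs_def] using g[OF x] \<Theta> by (intro borel_measurable_continuous_on_if) auto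
      have t: "(\<lambda>\<omega>. \<theta>0 + hhat n \<omega> / real n) \<in> borel_measurable ?S" using hhat by measurable
      have "(\<lambda>\<omega>. plug_in_boundary g \<Theta> \<theta>0 (junk n i \<omega>) n x (hhat n \<omega>))
         = (\<lambda>\<omega>. if \<theta>0 + hhat n \<omega> / real n \<in> \<Theta> then g0 (\<theta>0 + hhat n \<omega> / real n) else junk n i \<omega>)"
        by (auto simp: plug_in_boundary_def g0_def)
      also have "\<dots> \<in> borel_measurable ?S"
      proof (rule measurable_If)
        show "(\<lambda>\<omega>. g0 (\<theta>0 + hhat n \<omega> / real n)) \<in> borel_measurable ?S" by (rule measurable_compose[OF t g0])
        show "junk n i \<in> borel_measurable ?S" using i by (auto intro: junk)
        show "{\<omega> \<in> space ?S. \<theta>0 + hhat n \<omega> / real n \<in> \<Theta>} \<in> sets ?S"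
          using measurable_sets[OF t \<Theta>] by (simp add: vimage_def Int_def conj_commute)
      qed
      finally have [measurable]: "(\<lambda>\<omega>. plug_in_boundary g \<Theta> \<theta>0 (junk n i \<omega>) n x (hhat n \<omega>)) \<in> borel_measurable ?S" .
      note [measurable] = fst_m
      show "Measurable.pred ?S (\<lambda>\<omega>. fst (\<omega> i) < max (g x \<theta>0) (plug_in_boundary g \<Theta> \<theta>0 (junk n i \<omega>) n x (hhat n \<omega>)))"
        by measurable
    qed
    then show "Measurable.pred ?S (\<lambda>\<omega>. fst (\<omega> i) < max (g (snd (\<omega> i)) \<theta>0)
      (plug_in_boundary g \<Theta> \<theta>0 (junk n i \<omega>) n (snd (\<omega> i)) (hhat n \<omega>)))" by simp
  qed simp
  then have rej: "{\<omega> \<in> space ?S. \<exists>i\<in>{..<n}. fst (\<omega> i) < max (g (snd (\<omega> i)) \<theta>0)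
      (plug_in_boundary g \<Theta> \<theta>0 (junk n i \<omega>) n (snd (\<omega> i)) (hhat n \<omega>))} \<in> sets ?S"
    by (rule predE)
  have bex: "(\<exists>i<n. Q i) \<longleftrightarrow> (\<exists>i\<in>{..<n}. Q i)" for Q by auto
  show ?thesis
    unfolding phi_plus_def[abs_def] bex by (rule measurable_If[OF _ _ rej]) auto
qed

context boundary_model
begin

lemma rate_pos: "0 < rate"
  unfolding rate_def
proof (rule sum_pos[OF fin set_pmf_not_empty])
  fix x assume x: "x \<in> set_pmf pX"
  have "0 < f (g x \<theta>0) x (\<theta>0, \<gamma>)"
    using f_pos[OF x, of "g x \<theta>0" \<theta>0] bnd_int[OF x] interior_subset[of \<Y>] d by auto
  then show "0 < pmf pX x * (f (g x \<theta>0) x (\<theta>0, \<gamma>) * G x)"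
    using x G_pos by (simp add: pmf_positive)
qed

lemma snd_in_support: "\<omega> \<in> space (P h n) \<Longrightarrow> i < n \<Longrightarrow> snd (\<omega> i) \<in> set_pmf pX"
proof -
  assume \<omega>: "\<omega> \<in> space (P h n)" and i: "i < n"
  have "space (P h n) = (\<Pi>\<^sub>E i\<in>{..<n}. \<Y> \<times> set_pmf pX)"
    unfolding local_law_eq space_PiM by (simp add: space_dom_measure)
  then have "\<omega> i \<in> \<Y> \<times> set_pmf pX" using \<omega> i PiE_mem[of \<omega> "{..<n}" "\<lambda>_. \<Y> \<times> set_pmf pX" i] by simp
  then show ?thesis by (rule mem_Times_iff[THEN iffD1, THEN conjunct2])
qed

text \<open>
  Monotonicity of the curves turns closeness of \<open>hhat\<close> to \<open>hbar\<close> into inclusions between rejection regions, so that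
  the random threshold is enclosed by two deterministic ones. The bound \<open>0 \<le> hbar\<close> lets the upper curve also
  dominate the null boundary.
\<close>

lemma eventually_phi_plus_between:
  assumes sub: "ball \<theta>0 d \<subseteq> \<Theta>" and hbar: "0 \<le> hbar" and \<epsilon>: "0 < \<epsilon>"
  shows "\<forall>\<^sub>F n in sequentially. \<forall>\<omega>\<in>space (P h n). \<bar>hhat n \<omega> - hbar\<bar> \<le> \<epsilon> \<longrightarrow>
      ((\<exists>i<n. fst (\<omega> i) < g (snd (\<omega> i)) (\<theta>0 + (hbar - \<epsilon>) / real n)) \<longrightarrow> phi_plus g \<Theta> \<theta>0 junk hhat n \<omega> = 1)
    \<and> (phi_plus g \<Theta> \<theta>0 junk hhat n \<omega> = 1 \<longrightarrow> (\<exists>i<n. fst (\<omega> i) < g (snd (\<omega> i)) (\<theta>0 + (hbar + \<epsilon>) / real n)))"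
  using eventually_in_ball[of "hbar - \<epsilon>"] eventually_in_ball[of "hbar + \<epsilon>"] eventually_gt_at_top[of 0]
proof eventually_elim
  case (elim n)
  show ?case
  proof (intro ballI impI)
    fix \<omega> assume \<omega>: "\<omega> \<in> space (P h n)" and dev: "\<bar>hhat n \<omega> - hbar\<bar> \<le> \<epsilon>"
    let ?t = "\<theta>0 + hhat n \<omega> / real n"
    have le: "\<theta>0 + (hbar - \<epsilon>) / real n \<le> ?t" "?t \<le> \<theta>0 + (hbar + \<epsilon>) / real n" "\<theta>0 \<le> \<theta>0 + (hbar + \<epsilon>) / real n"
      using dev hbar \<epsilon> elim(3) by (auto intro!: divide_right_mono)
    have t: "?t \<in> ball \<theta>0 d"
      using le elim(1,2) unfolding ball_eq_greaterThanLessThan greaterThanLessThan_iff by linarith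
    then have plug: "plug_in_boundary g \<Theta> \<theta>0 j n x (hhat n \<omega>) = g x ?t" for j x
      using sub by (auto simp: plug_in_boundary_def)
    have mono: "g x (\<theta>0 + (hbar - \<epsilon>) / real n) \<le> g x ?t" "g x ?t \<le> g x (\<theta>0 + (hbar + \<epsilon>) / real n)"
      "g x \<theta>0 \<le> g x (\<theta>0 + (hbar + \<epsilon>) / real n)" if x: "x \<in> set_pmf pX" for x
      using le t elim(1,2) d by (auto intro!: mono_onD[OF g_mono[OF x]])
    have phi: "phi_plus g \<Theta> \<theta>0 junk hhat n \<omega>
        = (if \<exists>i<n. fst (\<omega> i) < max (g (snd (\<omega> i)) \<theta>0) (g (snd (\<omega> i)) ?t) then 1 else 0)"
      unfolding phi_plus_def plug ..
    have 1: "fst (\<omega> i) < max (g (snd (\<omega> i)) \<theta>0) (g (snd (\<omega> i)) ?t)"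
      if "i < n" "fst (\<omega> i) < g (snd (\<omega> i)) (\<theta>0 + (hbar - \<epsilon>) / real n)" for i
      using mono(1)[OF snd_in_support[OF \<omega> that(1)]] that(2) unfolding less_max_iff_disj by linarith
    have 2: "fst (\<omega> i) < g (snd (\<omega> i)) (\<theta>0 + (hbar + \<epsilon>) / real n)"
      if "i < n" "fst (\<omega> i) < max (g (snd (\<omega> i)) \<theta>0) (g (snd (\<omega> i)) ?t)" for i
      using mono(2,3)[OF snd_in_support[OF \<omega> that(1)]] that(2) unfolding less_max_iff_disj by linarith
    show "((\<exists>i<n. fst (\<omega> i) < g (snd (\<omega> i)) (\<theta>0 + (hbar - \<epsilon>) / real n)) \<longrightarrow> phi_plus g \<Theta> \<theta>0 junk hhat n \<omega> = 1)
    \<and> (phi_plus g \<Theta> \<theta>0 junk hhat n \<omega> = 1 \<longrightarrow> (\<exists>i<n. fst (\<omega> i) < g (snd (\<omega> i)) (\<theta>0 + (hbar + \<epsilon>) / real n)))"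
    proof (cases "\<exists>i<n. fst (\<omega> i) < max (g (snd (\<omega> i)) \<theta>0) (g (snd (\<omega> i)) ?t)")
      case True
      then have "phi_plus g \<Theta> \<theta>0 junk hhat n \<omega> = 1" unfolding phi by (rule if_P)
      then show ?thesis using True 2 by blast
    next
      case False
      then have "phi_plus g \<Theta> \<theta>0 junk hhat n \<omega> = 0" unfolding phi by (rule if_not_P)
      then show ?thesis using False 1 by auto
    qed
  qed
qed

lemma phi_plus_expectation_bounds:
  fixes h :: real
  assumes sub: "ball \<theta>0 d \<subseteq> \<Theta>" and hbar: "0 \<le> hbar" and \<epsilon>: "0 < \<epsilon>"
    and phi_m: "\<And>n. phi_plus g \<Theta> \<theta>0 junk hhat n \<in> borel_measurable (sample_space \<Y> pX n)"
    and hhat_m: "\<And>n. hhat n \<in> borel_measurable (sample_space \<Y> pX n)"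
  defines "cr t \<equiv> \<lambda>n. measure (P h n) {\<omega> \<in> space (P h n). \<exists>i<n. fst (\<omega> i) < g (snd (\<omega> i)) (\<theta>0 + t / real n)}"
    and "dev \<equiv> \<lambda>n. measure (P h n) {\<omega> \<in> space (P h n). \<epsilon> < \<bar>hhat n \<omega> - hbar\<bar>}"
    and "E \<equiv> \<lambda>n. \<integral>\<omega>. phi_plus g \<Theta> \<theta>0 junk hhat n \<omega> \<partial>P h n"
  shows "\<forall>\<^sub>F n in sequentially. cr (hbar - \<epsilon>) n - dev n \<le> E n \<and> E n \<le> cr (hbar + \<epsilon>) n + dev n"
  using eventually_phi_plus_between[OF sub hbar \<epsilon>, of h hhat junk] eventually_in_ball[of h]
proof eventually_elim
  case (elim n)
  interpret prob_space "P h n" by (rule prob_space_local_law[OF elim(2)])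
  let ?phi = "phi_plus g \<Theta> \<theta>0 junk hhat n"
  have sets: "sets (P h n) = sets (sample_space \<Y> pX n)" by (simp add: local_law_def sets_sample_law)
  have [measurable]: "?phi \<in> borel_measurable (P h n)" "hhat n \<in> borel_measurable (P h n)"
    using phi_m hhat_m by (simp_all add: measurable_cong_sets[OF sets refl])
  define R where "R = {\<omega> \<in> space (P h n). ?phi \<omega> = 1}"
  define B where "B t = {\<omega> \<in> space (P h n). \<exists>i<n. fst (\<omega> i) < g (snd (\<omega> i)) (\<theta>0 + t / real n)}" for t
  define V where "V = {\<omega> \<in> space (P h n). \<epsilon> < \<bar>hhat n \<omega> - hbar\<bar>}"
  have [measurable]: "R \<in> sets (P h n)" "V \<in> sets (P h n)" unfolding R_def V_def by measurable
  have [measurable]: "B t \<in> sets (P h n)" for t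
    unfolding B_def by (rule prob_some_crossing(1)[OF elim(2)])
  have "E n = (\<integral>\<omega>. indicator R \<omega> \<partial>P h n)"
    unfolding E_def by (intro Bochner_Integration.integral_cong refl) (auto simp: R_def phi_plus_def)
  also have "\<dots> = measure (P h n) R"
    using sets.sets_into_space[of R "P h n"] by (simp add: Int_absorb2)
  finally have E: "E n = measure (P h n) R" .
  have key: "(\<omega> \<in> B (hbar - \<epsilon>) \<longrightarrow> \<omega> \<in> R) \<and> (\<omega> \<in> R \<longrightarrow> \<omega> \<in> B (hbar + \<epsilon>))"
    if \<omega>: "\<omega> \<in> space (P h n)" "\<omega> \<notin> V" for \<omega>
  proof -
    have "\<bar>hhat n \<omega> - hbar\<bar> \<le> \<epsilon>" using \<omega> by (simp add: V_def)
    from mp[OF bspec[OF elim(1) \<omega>(1)] this] show ?thesis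
      using \<omega>(1) unfolding B_def R_def mem_Collect_eq by blast
  qed
  have sp: "B t \<subseteq> space (P h n)" "R \<subseteq> space (P h n)" for t by (auto simp: B_def R_def)
  have "measure (P h n) (B (hbar - \<epsilon>)) \<le> measure (P h n) (R \<union> V)"
  proof (rule finite_measure_mono)
    show "B (hbar - \<epsilon>) \<subseteq> R \<union> V" using key sp by blast
  qed measurable
  also have "\<dots> \<le> measure (P h n) R + measure (P h n) V" by (rule measure_Un_le) measurable
  finally have lower: "measure (P h n) (B (hbar - \<epsilon>)) \<le> measure (P h n) R + measure (P h n) V" .
  have "measure (P h n) R \<le> measure (P h n) (B (hbar + \<epsilon>) \<union> V)"
  proof (rule finite_measure_mono)
    show "R \<subseteq> B (hbar + \<epsilon>) \<union> V" using key sp by blast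
  qed measurable
  also have "\<dots> \<le> measure (P h n) (B (hbar + \<epsilon>)) + measure (P h n) V" by (rule measure_Un_le) measurable
  finally have "measure (P h n) R \<le> measure (P h n) (B (hbar + \<epsilon>)) + measure (P h n) V" .
  with lower have "measure (P h n) (B (hbar - \<epsilon>)) - measure (P h n) V \<le> E n
      \<and> E n \<le> measure (P h n) (B (hbar + \<epsilon>)) + measure (P h n) V"
    unfolding E by linarith
  then show ?case unfolding cr_def dev_def B_def V_def .
qed

text \<open>
  The limits of the two enclosing crossing probabilities depend continuously on the threshold, so they meet as
  \<open>\<epsilon>\<close> tends to \<open>0\<close>.
\<close>

theorem phi_plus_limit:
  assumes sub: "ball \<theta>0 d \<subseteq> \<Theta>" and hbar: "0 \<le> hbar"
    and phi_m: "\<And>n. phi_plus g \<Theta> \<theta>0 junk hhat n \<in> borel_measurable (sample_space \<Y> pX n)"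
    and cons: "sqrt_n_consistent (sample_space \<Y> pX) (P h) hhat hbar"
  shows "(\<lambda>n. \<integral>\<omega>. phi_plus g \<Theta> \<theta>0 junk hhat n \<omega> \<partial>P h n) \<longlonglongrightarrow> 1 - exp (- (rate * max 0 (hbar - h)))"
proof -
  define E where "E n = (\<integral>\<omega>. phi_plus g \<Theta> \<theta>0 junk hhat n \<omega> \<partial>P h n)" for n
  define L where "L t = 1 - exp (- (rate * max 0 (t - h)))" for t
  define cr where "cr t n = measure (P h n) {\<omega> \<in> space (P h n). \<exists>i<n. fst (\<omega> i) < g (snd (\<omega> i)) (\<theta>0 + t / real n)}" for t n
  define dev where "dev \<epsilon> n = measure (P h n) {\<omega> \<in> space (P h n). \<epsilon> < \<bar>hhat n \<omega> - hbar\<bar>}" for \<epsilon> n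
  have hhat_m: "\<And>n. hhat n \<in> borel_measurable (sample_space \<Y> pX n)"
    using cons by (simp add: sqrt_n_consistent_def)
  have prob: "\<forall>\<^sub>F n in sequentially. prob_space (P h n)"
    using eventually_in_ball[of h] by eventually_elim (rule prob_space_local_law)
  have sets: "sets (P h n) = sets (sample_space \<Y> pX n)" for n by (simp add: local_law_def sets_sample_law)
  have cr: "cr t \<longlonglongrightarrow> L t" for t
    unfolding cr_def[abs_def] L_def by (rule some_crossing_limit)
  have dev: "dev \<epsilon> \<longlonglongrightarrow> 0" if "0 < \<epsilon>" for \<epsilon>
    unfolding dev_def[abs_def] by (rule sqrt_n_consistent_imp_consistent[OF cons sets prob that])
  have bounds: "\<forall>\<^sub>F n in sequentially. cr (hbar - \<epsilon>) n - dev \<epsilon> n \<le> E n \<and> E n \<le> cr (hbar + \<epsilon>) n + dev \<epsilon> n"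
    if "0 < \<epsilon>" for \<epsilon>
    unfolding cr_def dev_def E_def by (rule phi_plus_expectation_bounds[OF sub hbar that phi_m hhat_m])
  have "isCont L hbar" unfolding L_def[abs_def] by (intro continuous_intros)
  then have L: "(L \<longlongrightarrow> L hbar) (nhds hbar)" by (simp add: isCont_def tendsto_at_iff_tendsto_nhds)
  have "E \<longlonglongrightarrow> L hbar"
  proof (rule order_tendstoI)
    fix a assume "a < L hbar"
    then have "\<forall>\<^sub>F t in nhds hbar. a < L t" by (rule order_tendstoD(1)[OF L])
    then obtain e where e: "0 < e" "\<And>t. dist t hbar < e \<Longrightarrow> a < L t" unfolding eventually_nhds_metric by blast
    have \<epsilon>: "0 < e / 2" using e(1) by simp
    have "a < L (hbar - e / 2)" using e by (intro e(2)) (simp add: dist_real_def)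
    moreover have "(\<lambda>n. cr (hbar - e / 2) n - dev (e / 2) n) \<longlonglongrightarrow> L (hbar - e / 2) - 0"
      by (rule tendsto_diff[OF cr dev[OF \<epsilon>]])
    ultimately have "\<forall>\<^sub>F n in sequentially. a < cr (hbar - e / 2) n - dev (e / 2) n"
      by (intro order_tendstoD(1)) auto
    with bounds[OF \<epsilon>] show "\<forall>\<^sub>F n in sequentially. a < E n"
      by eventually_elim (rule less_le_trans, assumption, rule conjunct1)
  next
    fix a assume "L hbar < a"
    then have "\<forall>\<^sub>F t in nhds hbar. L t < a" by (rule order_tendstoD(2)[OF L])
    then obtain e where e: "0 < e" "\<And>t. dist t hbar < e \<Longrightarrow> L t < a" unfolding eventually_nhds_metric by blast
    have \<epsilon>: "0 < e / 2" using e(1) by simp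
    have "L (hbar + e / 2) < a" using e by (intro e(2)) (simp add: dist_real_def)
    moreover have "(\<lambda>n. cr (hbar + e / 2) n + dev (e / 2) n) \<longlonglongrightarrow> L (hbar + e / 2) + 0"
      by (rule tendsto_add[OF cr dev[OF \<epsilon>]])
    ultimately have "\<forall>\<^sub>F n in sequentially. cr (hbar + e / 2) n + dev (e / 2) n < a"
      by (intro order_tendstoD(2)) auto
    with bounds[OF \<epsilon>] show "\<forall>\<^sub>F n in sequentially. E n < a"
      by eventually_elim (rule le_less_trans, rule conjunct2)
  qed
  then show ?thesis by (simp add: E_def[abs_def] L_def)
qed

end

section \<open>Reduction to a boundary model and optimality\<close>

text \<open>
  Only the derivative at \<open>\<theta>0\<close> is assumed positive; its continuity extends the sign to a neighbourhood.
\<close>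

lemma eventually_mono_on_ball:
  fixes \<phi> :: "real \<Rightarrow> real"
  assumes cd: "cont_diff \<Theta> \<phi>" and \<theta>0: "\<theta>0 \<in> interior \<Theta>" and pos: "0 < deriv \<phi> \<theta>0"
  shows "(\<phi> has_real_derivative deriv \<phi> \<theta>0) (at \<theta>0)"
    and "\<forall>\<^sub>F d in at_right 0. mono_on (ball \<theta>0 d) \<phi>"
proof -
  obtain D\<phi> where D: "\<And>\<theta>. \<theta> \<in> \<Theta> \<Longrightarrow> (\<phi> has_real_derivative D\<phi> \<theta>) (at \<theta> within \<Theta>)" and cont: "continuous_on \<Theta> D\<phi>"
    using cd unfolding cont_diff_def by blast
  have at: "(\<phi> has_real_derivative D\<phi> \<theta>) (at \<theta>)" if "\<theta> \<in> interior \<Theta>" for \<theta>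
    using D[OF subsetD[OF interior_subset that]] at_within_interior[OF that] by simp
  then have eq: "deriv \<phi> \<theta>0 = D\<phi> \<theta>0" using \<theta>0 by (intro DERIV_imp_deriv)
  show "(\<phi> has_real_derivative deriv \<phi> \<theta>0) (at \<theta>0)" using at[OF \<theta>0] eq by simp
  have "continuous_on (interior \<Theta>) D\<phi>" using cont interior_subset by (rule continuous_on_subset)
  then have "isCont D\<phi> \<theta>0" using \<theta>0 by (simp add: continuous_on_eq_continuous_at)
  then have "\<forall>\<^sub>F \<theta> in nhds \<theta>0. 0 < D\<phi> \<theta>"
    using pos eq by (intro order_tendstoD(1)[of D\<phi> "D\<phi> \<theta>0"])
      (auto simp: isCont_def tendsto_at_iff_tendsto_nhds)
  moreover have "\<forall>\<^sub>F \<theta> in nhds \<theta>0. \<theta> \<in> interior \<Theta>" using \<theta>0 by (intro eventually_nhds_in_open) auto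
  ultimately have "\<forall>\<^sub>F \<theta> in nhds \<theta>0. 0 < D\<phi> \<theta> \<and> \<theta> \<in> interior \<Theta>" by (rule eventually_conj)
  then obtain e where e: "0 < e" "\<And>\<theta>. \<theta> \<in> ball \<theta>0 e \<Longrightarrow> 0 < D\<phi> \<theta> \<and> \<theta> \<in> interior \<Theta>"
    by (auto simp: eventually_nhds_metric dist_commute)
  have "mono_on (ball \<theta>0 d) \<phi>" if "d < e" for d
  proof (rule mono_onI)
    fix r s assume rs: "r \<in> ball \<theta>0 d" "s \<in> ball \<theta>0 d" "r \<le> s"
    show "\<phi> r \<le> \<phi> s"
    proof (rule DERIV_nonneg_imp_nondecreasing[OF rs(3)])
      fix t assume t: "r \<le> t" "t \<le> s"
      have "t \<in> ball \<theta>0 e" using t rs \<open>d < e\<close> by (auto simp: dist_real_def)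
      then show "\<exists>y. DERIV \<phi> t :> y \<and> 0 \<le> y" using e(2) at by (meson less_imp_le)
    qed
  qed
  moreover have "\<forall>\<^sub>F d in at_right 0. d < e" using e(1) by (rule order_tendstoD(2)[OF tendsto_ident_at])
  ultimately show "\<forall>\<^sub>F d in at_right 0. mono_on (ball \<theta>0 d) \<phi>" by (auto elim: eventually_mono)
qed

text \<open>
  Restriction to the line through \<open>(\<theta>0, \<gamma>)\<close> in the direction \<open>(1, 0)\<close>. Taking \<open>\<beta>' = \<beta>\<close> in the joint
  supremum bounds \<open>D\<^sup>2 / f = (D / f)\<^sup>2 f\<close> by the information envelope. Finitely many covariate values leave a common radius on
  which all curves increase.
\<close>

lemma boundary_model_of_assumption_B:
  assumes model: "assumption_B_model \<Y> pX f g \<Theta> \<Gamma> \<H> \<theta>0 \<gamma>"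
    and reg: "assumption_B_regularity \<Y> pX f g \<Theta> \<Gamma> \<theta>0 \<gamma>"
  obtains d C D where "boundary_model \<Y> pX f g \<gamma> \<theta>0 d C D (\<lambda>x. deriv (g x) \<theta>0)" "ball \<theta>0 d \<subseteq> \<Theta>"
proof -
  let ?S = "set_pmf pX"
  have Y: "\<Y> \<in> sets borel" and fin: "finite ?S" and bnd: "\<And>x. x \<in> ?S \<Longrightarrow> g x \<theta>0 \<in> interior \<Y>"
    and dens: "\<And>x \<beta>. x \<in> ?S \<Longrightarrow> \<beta> \<in> \<Theta> \<times> \<Gamma> \<Longrightarrow> cond_density f g \<beta> x \<in> borel_measurable (lebesgue_on_Y \<Y>)"
      "\<And>x \<beta>. x \<in> ?S \<Longrightarrow> \<beta> \<in> \<Theta> \<times> \<Gamma> \<Longrightarrow> (\<integral>\<^sup>+ y. ennreal (cond_density f g \<beta> x y) \<partial>lebesgue_on_Y \<Y>) = 1"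
    and \<theta>0: "\<theta>0 \<in> interior \<Theta>"
    using model unfolding assumption_B_model_def by auto
  obtain Df D2f \<N> C where
      diff: "\<And>y x. y \<in> \<Y> \<Longrightarrow> x \<in> ?S \<Longrightarrow> twice_cont_diff (\<Theta> \<times> \<Gamma>) (f y x) (Df y x) (D2f y x)"
    and g_diff: "\<And>x. x \<in> ?S \<Longrightarrow> cont_diff \<Theta> (g x)"
    and \<N>: "open \<N>" "(\<theta>0, \<gamma>) \<in> \<N>" "\<N> \<subseteq> \<Theta> \<times> \<Gamma>"
    and f_cont: "\<And>x \<beta>. x \<in> ?S \<Longrightarrow> \<beta> \<in> \<N> \<Longrightarrow> continuous_on \<Y> (\<lambda>y. f y x \<beta>)"
    and f_pos: "\<And>y x \<beta>. y \<in> \<Y> \<Longrightarrow> x \<in> ?S \<Longrightarrow> \<beta> \<in> \<N> \<Longrightarrow> 0 < f y x \<beta>"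
    and Df_bound: "\<And>y x \<beta>. y \<in> \<Y> \<Longrightarrow> x \<in> ?S \<Longrightarrow> \<beta> \<in> \<N> \<Longrightarrow> norm (Df y x \<beta>) < C"
    and info: "\<And>x. x \<in> ?S \<Longrightarrow> (\<integral>\<^sup>+ y. (SUP (\<beta>', \<beta>)\<in>\<N> \<times> \<N>.
                   ennreal ((norm (Df y x \<beta>'))\<^sup>2 / (f y x \<beta>')\<^sup>2
                     * indicator {g x (fst \<beta>)..} y * f y x \<beta>)) \<partial>lebesgue_on_Y \<Y>) < \<infinity>"
    and g_pos: "\<And>x. x \<in> ?S \<Longrightarrow> 0 < deriv (g x) \<theta>0"
    using reg unfolding assumption_B_regularity_def
  proof (elim exE conjE, goal_cases)
    case (1 Df D2f \<N> C)
    show ?thesis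
    proof (rule 1(1)[of Df D2f \<N> C])
      fix x assume x: "x \<in> ?S"
      show "cont_diff \<Theta> (g x)" by (rule bspec[OF 1(3) x])
      show "0 < deriv (g x) \<theta>0" by (rule conjunct1[OF bspec[OF 1(10) x]])
      show "(\<integral>\<^sup>+ y. (SUP (\<beta>', \<beta>)\<in>\<N> \<times> \<N>. ennreal ((norm (Df y x \<beta>'))\<^sup>2 / (f y x \<beta>')\<^sup>2
          * indicator {g x (fst \<beta>)..} y * f y x \<beta>)) \<partial>lebesgue_on_Y \<Y>) < \<infinity>"
        by (rule conjunct1[OF conjunct2[OF bspec[OF 1(9) x]]])
    next
      fix x \<beta> assume x: "x \<in> ?S" "\<beta> \<in> \<N>"
      show "continuous_on \<Y> (\<lambda>y. f y x \<beta>)" by (rule conjunct1[OF bspec[OF bspec[OF 1(7) x(1)] x(2)]])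
    next
      fix y x \<beta> assume yx: "y \<in> \<Y>" "x \<in> ?S" "\<beta> \<in> \<N>"
      note * = bspec[OF bspec[OF bspec[OF 1(8) yx(1)] yx(2)] yx(3)]
      show "0 < f y x \<beta>" "norm (Df y x \<beta>) < C" using * by blast+
    next
      fix y x assume yx: "y \<in> \<Y>" "x \<in> ?S"
      show "twice_cont_diff (\<Theta> \<times> \<Gamma>) (f y x) (Df y x) (D2f y x)"
        by (rule bspec[OF bspec[OF 1(2) yx(1)] yx(2)])
    qed (rule 1(4) 1(5) 1(6))+
  qed
  have "\<forall>\<^sub>F d in at_right 0. \<forall>x\<in>?S. mono_on (ball \<theta>0 d) (g x)"
    using fin eventually_mono_on_ball(2)[OF g_diff \<theta>0 g_pos] by (intro eventually_ball_finite) auto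
  moreover obtain e where e: "0 < e" "ball (\<theta>0, \<gamma>) e \<subseteq> \<N>" using \<N> by (auto simp: open_contains_ball)
  have "\<forall>\<^sub>F d in at_right 0. d < e" using e(1) by (rule order_tendstoD(2)[OF tendsto_ident_at])
  moreover have "\<forall>\<^sub>F d in at_right (0::real). 0 < d" by (simp add: eventually_at_filter)
  ultimately have "\<forall>\<^sub>F d in at_right 0. (\<forall>x\<in>?S. mono_on (ball \<theta>0 d) (g x)) \<and> d < e \<and> 0 < d"
    by (intro eventually_conj)
  from eventually_happens'[OF trivial_limit_at_right_real this]
  obtain d where d: "\<And>x. x \<in> ?S \<Longrightarrow> mono_on (ball \<theta>0 d) (g x)" "d < e" "0 < d" by blast
  have in_N: "(\<theta>, \<gamma>) \<in> \<N>" if "\<theta> \<in> ball \<theta>0 d" for \<theta>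
    using that d(2) e(2) by (auto simp: dist_Pair_Pair subset_iff)
  have sub: "ball \<theta>0 d \<subseteq> \<Theta>"
  proof
    fix \<theta> assume "\<theta> \<in> ball \<theta>0 d"
    then have "(\<theta>, \<gamma>) \<in> \<Theta> \<times> \<Gamma>" using in_N \<N>(3) by blast
    then show "\<theta> \<in> \<Theta>" by simp
  qed
  define D where "D y x \<theta> = Df y x (\<theta>, \<gamma>) \<bullet> (1, 0)" for y x \<theta>
  have D_le: "\<bar>D y x \<theta>\<bar> \<le> norm (Df y x (\<theta>, \<gamma>))" for y x \<theta>
    using Cauchy_Schwarz_ineq2[of "Df y x (\<theta>, \<gamma>)" "(1, 0)"] by (simp add: D_def norm_Pair)
  have "boundary_model \<Y> pX f g \<gamma> \<theta>0 d C D (\<lambda>x. deriv (g x) \<theta>0)"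
  proof
    fix x assume x: "x \<in> ?S"
    show "g x \<theta>0 \<in> interior \<Y>" by (rule bnd[OF x])
    show "continuous_on \<Y> (\<lambda>y. f y x (\<theta>0, \<gamma>))" by (rule f_cont[OF x \<N>(2)])
    show "(g x has_real_derivative deriv (g x) \<theta>0) (at \<theta>0)"
      by (rule eventually_mono_on_ball(1)[OF g_diff[OF x] \<theta>0 g_pos[OF x]])
    show "0 < deriv (g x) \<theta>0" by (rule g_pos[OF x])
    show "mono_on (ball \<theta>0 d) (g x)" by (rule d(1)[OF x])
    have "(\<integral>\<^sup>+ y. (SUP \<theta>\<in>ball \<theta>0 d. ennreal ((D y x \<theta>)\<^sup>2 / f y x (\<theta>, \<gamma>) * indicator {g x \<theta>..} y)) \<partial>lebesgue_on_Y \<Y>)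
      \<le> (\<integral>\<^sup>+ y. (SUP (\<beta>', \<beta>)\<in>\<N> \<times> \<N>. ennreal ((norm (Df y x \<beta>'))\<^sup>2 / (f y x \<beta>')\<^sup>2
                     * indicator {g x (fst \<beta>)..} y * f y x \<beta>)) \<partial>lebesgue_on_Y \<Y>)"
    proof (intro nn_integral_mono SUP_least)
      fix y \<theta> assume "y \<in> space (lebesgue_on_Y \<Y>)" and \<theta>: "\<theta> \<in> ball \<theta>0 d"
      then have y: "y \<in> \<Y>" by (simp add: lebesgue_on_Y_def space_restrict_space)
      note f0 = f_pos[OF y x in_N[OF \<theta>]]
      have "(D y x \<theta>)\<^sup>2 \<le> (norm (Df y x (\<theta>, \<gamma>)))\<^sup>2" using power_mono[OF D_le, of y x \<theta> 2] by simp
      then have "(D y x \<theta>)\<^sup>2 / f y x (\<theta>, \<gamma>) * indicator {g x \<theta>..} y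
          \<le> (norm (Df y x (\<theta>, \<gamma>)))\<^sup>2 / f y x (\<theta>, \<gamma>) * indicator {g x \<theta>..} y"
        using f0 by (intro mult_right_mono divide_right_mono) auto
      also have "\<dots> = (norm (Df y x (\<theta>, \<gamma>)))\<^sup>2 / (f y x (\<theta>, \<gamma>))\<^sup>2
          * indicator {g x (fst (\<theta>, \<gamma>))..} y * f y x (\<theta>, \<gamma>)"
        using f0 by (simp add: power2_eq_square)
      finally have "ennreal ((D y x \<theta>)\<^sup>2 / f y x (\<theta>, \<gamma>) * indicator {g x \<theta>..} y)
          \<le> (\<lambda>(\<beta>', \<beta>). ennreal ((norm (Df y x \<beta>'))\<^sup>2 / (f y x \<beta>')\<^sup>2
              * indicator {g x (fst \<beta>)..} y * f y x \<beta>)) ((\<theta>, \<gamma>), (\<theta>, \<gamma>))"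
        by (simp add: ennreal_leI)
      also have "\<dots> \<le> (SUP (\<beta>', \<beta>)\<in>\<N> \<times> \<N>. ennreal ((norm (Df y x \<beta>'))\<^sup>2 / (f y x \<beta>')\<^sup>2
              * indicator {g x (fst \<beta>)..} y * f y x \<beta>))"
        using in_N[OF \<theta>] by (intro SUP_upper) auto
      finally show "ennreal ((D y x \<theta>)\<^sup>2 / f y x (\<theta>, \<gamma>) * indicator {g x \<theta>..} y)
          \<le> (SUP (\<beta>', \<beta>)\<in>\<N> \<times> \<N>. ennreal ((norm (Df y x \<beta>'))\<^sup>2 / (f y x \<beta>')\<^sup>2
              * indicator {g x (fst \<beta>)..} y * f y x \<beta>))" .
    qed
    then show "(\<integral>\<^sup>+ y. (SUP \<theta>\<in>ball \<theta>0 d. ennreal ((D y x \<theta>)\<^sup>2 / f y x (\<theta>, \<gamma>) * indicator {g x \<theta>..} y))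
        \<partial>lebesgue_on_Y \<Y>) < \<infinity>"
      using info[OF x] by (rule le_less_trans)
    fix \<theta> assume \<theta>: "\<theta> \<in> ball \<theta>0 d"
    have \<beta>: "(\<theta>, \<gamma>) \<in> \<Theta> \<times> \<Gamma>" using in_N[OF \<theta>] \<N>(3) by blast
    show "cond_density f g (\<theta>, \<gamma>) x \<in> borel_measurable (lebesgue_on_Y \<Y>)" by (rule dens(1)[OF x \<beta>])
    show "(\<integral>\<^sup>+ y. ennreal (cond_density f g (\<theta>, \<gamma>) x y) \<partial>lebesgue_on_Y \<Y>) = 1" by (rule dens(2)[OF x \<beta>])
    fix y assume y: "y \<in> \<Y>"
    show "0 < f y x (\<theta>, \<gamma>)" by (rule f_pos[OF y x in_N[OF \<theta>]])
    show "\<bar>D y x \<theta>\<bar> \<le> C" using D_le[of y x \<theta>] Df_bound[OF y x in_N[OF \<theta>]] by linarith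
    have "(f y x has_derivative (\<lambda>v. Df y x (\<theta>, \<gamma>) \<bullet> v)) (at (\<theta>, \<gamma>) within \<Theta> \<times> \<Gamma>)"
      using diff[OF y x] \<beta> by (simp add: twice_cont_diff_def)
    then have "(f y x has_derivative (\<lambda>v. Df y x (\<theta>, \<gamma>) \<bullet> v)) (at (\<theta>, \<gamma>) within \<N>)"
      using \<N>(3) by (rule has_derivative_subset)
    then have F: "(f y x has_derivative (\<lambda>v. Df y x (\<theta>, \<gamma>) \<bullet> v)) (at (\<theta>, \<gamma>))"
      unfolding at_within_open[OF in_N[OF \<theta>] \<N>(1)] .
    have "((\<lambda>\<theta>. (\<theta>, \<gamma>)) has_derivative (\<lambda>t. (t, 0))) (at \<theta>)"
      by (intro derivative_intros)
    from has_derivative_compose[OF this F]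
    have chain: "((\<lambda>\<theta>. f y x (\<theta>, \<gamma>)) has_derivative (\<lambda>t. Df y x (\<theta>, \<gamma>) \<bullet> (t, 0))) (at \<theta>)" .
    have "Df y x (\<theta>, \<gamma>) \<bullet> (t, 0) = D y x \<theta> * t" for t
      unfolding D_def by (cases "Df y x (\<theta>, \<gamma>)") (simp add: inner_Pair)
    then have "(\<lambda>t. Df y x (\<theta>, \<gamma>) \<bullet> (t, 0)) = (*) (D y x \<theta>)" by (rule ext)
    with chain show "((\<lambda>\<theta>. f y x (\<theta>, \<gamma>)) has_real_derivative D y x \<theta>) (at \<theta>)"
      unfolding has_field_derivative_def by simp
  qed (use Y fin d in auto)
  from this sub show ?thesis by (rule that)
qed

theorem theorem5:
  fixes \<Y> \<Theta> \<H> :: "real set"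
    and \<Gamma> :: "(real^'d) set"
    and pX :: "(real^'dx) pmf"
    and f :: "real \<Rightarrow> real^'dx \<Rightarrow> real \<times> (real^'d) \<Rightarrow> real"
    and g :: "real^'dx \<Rightarrow> real \<Rightarrow> real"
    and \<theta>0 \<alpha> lam hbar :: real
    and \<gamma> :: "real^'d"
    and hhat :: "nat \<Rightarrow> (nat \<Rightarrow> real \<times> (real^'dx)) \<Rightarrow> real"
    and \<gamma>hat :: "nat \<Rightarrow> (nat \<Rightarrow> real \<times> (real^'dx)) \<Rightarrow> real^'d"
    and junk :: "nat \<Rightarrow> nat \<Rightarrow> (nat \<Rightarrow> real \<times> (real^'dx)) \<Rightarrow> real"
  assumes "0 < \<alpha>" "\<alpha> < 1"
    and "\<gamma> \<in> \<Gamma>"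
    and "lam = inverse (measure_pmf.expectation pX
           (\<lambda>x. f (g x \<theta>0) x (\<theta>0, \<gamma>) * deriv (g x) \<theta>0))"
    and "hbar = lam * ln (1 / (1 - \<alpha>))"
    and "hbar \<in> \<H>"
    and "\<forall>h\<in>\<H>. assumption_B \<Y> pX f g \<Theta> \<Gamma> \<H> \<theta>0 \<gamma> hhat hbar \<gamma>hat h"
    and "\<forall>n. \<forall>i<n. junk n i \<in> borel_measurable (sample_space \<Y> pX n)"
  shows "AUMP (sample_space \<Y> pX) (local_law \<Y> pX f g \<theta>0 \<gamma>)
           {h \<in> \<H>. h \<ge> 0} {h \<in> \<H>. h < 0} \<alpha>
           (phi_plus g \<Theta> \<theta>0 junk hhat)"
proof -
  let ?S = "sample_space \<Y> pX" and ?P = "local_law \<Y> pX f g \<theta>0 \<gamma>" and ?\<phi> = "phi_plus g \<Theta> \<theta>0 junk hhat"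
  have B: "assumption_B \<Y> pX f g \<Theta> \<Gamma> \<H> \<theta>0 \<gamma> hhat hbar \<gamma>hat h" if "h \<in> \<H>" for h
    using assms(7) that by blast
  have model: "assumption_B_model \<Y> pX f g \<Theta> \<Gamma> \<H> \<theta>0 \<gamma>"
    and reg: "assumption_B_regularity \<Y> pX f g \<Theta> \<Gamma> \<theta>0 \<gamma>"
    using B[OF assms(6)] by (auto simp: assumption_B_def)
  have cons: "sqrt_n_consistent ?S (?P h) hhat hbar" if "h \<in> \<H>" for h
    using B[OF that] by (simp add: assumption_B_def)
  obtain d C D where bm: "boundary_model \<Y> pX f g \<gamma> \<theta>0 d C D (\<lambda>x. deriv (g x) \<theta>0)" and sub: "ball \<theta>0 d \<subseteq> \<Theta>"
    by (rule boundary_model_of_assumption_B[OF model reg])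
  interpret boundary_model \<Y> pX f g \<gamma> \<theta>0 d C D "\<lambda>x. deriv (g x) \<theta>0" by (rule bm)
  have zero: "0 \<in> \<H>" using model by (simp add: assumption_B_model_def)
  have "measure_pmf.expectation pX (\<lambda>x. f (g x \<theta>0) x (\<theta>0, \<gamma>) * deriv (g x) \<theta>0) = rate"
    unfolding rate_def by (subst integral_measure_pmf[OF fin]) auto
  then have rh: "rate * hbar = - ln (1 - \<alpha>)"
    using assms(1,2,4,5) rate_pos by (simp add: ln_div)
  have "0 < rate * hbar" unfolding rh using assms(1,2) by simp
  then have hbar: "0 \<le> hbar" using rate_pos by (simp add: zero_less_mult_iff)
  have \<Theta>: "\<Theta> \<in> sets borel"
  proof -
    have "convex (fst ` (\<Theta> \<times> \<Gamma>))"
      using model by (intro convex_linear_image linear_fst) (simp add: assumption_B_model_def)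
    moreover have "fst ` (\<Theta> \<times> \<Gamma>) = \<Theta>" using assms(3) by force
    ultimately show ?thesis by (simp add: real_interval_borel_measurable is_interval_convex_1)
  qed
  have g_cont: "continuous_on \<Theta> (g x)" if "x \<in> set_pmf pX" for x
  proof -
    have "cont_diff \<Theta> (g x)" using reg that by (auto simp: assumption_B_regularity_def)
    then show ?thesis by (auto simp: cont_diff_def intro: DERIV_continuous_on)
  qed
  have \<phi>_meas: "?\<phi> n \<in> borel_measurable (?S n)" for n
  proof (rule phi_plus_measurable[OF fin \<Theta> g_cont])
    show "hhat n \<in> borel_measurable (?S n)" using cons[OF zero] by (simp add: sqrt_n_consistent_def)
  qed (use assms(8) in auto)
  have limit: "(\<lambda>n. ereal (\<integral>\<omega>. ?\<phi> n \<omega> \<partial>?P h n)) \<longlonglongrightarrow> ereal (1 - exp (- (rate * max 0 (hbar - h))))" if "h \<in> \<H>" for h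
    by (intro tendsto_ereal phi_plus_limit[OF sub hbar \<phi>_meas cons[OF that]])
  show ?thesis
    unfolding AUMP_def asymptotic_level_def
  proof (intro conjI allI ballI impI)
    show "is_test (?S n) (?\<phi> n)" for n using \<phi>_meas by (auto simp: is_test_def phi_plus_def)
  next
    fix h assume h: "h \<in> {h \<in> \<H>. 0 \<le> h}"
    have "limsup (\<lambda>n. ereal (\<integral>\<omega>. ?\<phi> n \<omega> \<partial>?P h n)) = ereal (1 - exp (- (rate * max 0 (hbar - h))))"
      using limit[of h] h by (intro lim_imp_Limsup) auto
    also have "\<dots> \<le> ereal (1 - exp (- (rate * hbar)))"
      using h hbar rate_pos by simp
    also have "\<dots> = ereal \<alpha>" using assms(2) by (simp add: rh)
    finally show "limsup (\<lambda>n. ereal (\<integral>\<omega>. ?\<phi> n \<omega> \<partial>?P h n)) \<le> ereal \<alpha>" .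
  next
    fix \<psi> h
    assume test: "\<forall>n. is_test (?S n) (\<psi> n)"
      and level: "\<forall>h\<in>{h \<in> \<H>. 0 \<le> h}. limsup (\<lambda>n. ereal (\<integral>\<omega>. \<psi> n \<omega> \<partial>?P h n)) \<le> ereal \<alpha>"
      and h: "h \<in> {h \<in> \<H>. h < 0}"
    have "limsup (\<lambda>n. ereal (\<integral>\<omega>. \<psi> n \<omega> \<partial>?P h n)) \<le> ereal (1 - exp (rate * h) * (1 - \<alpha>))"
      using h test level zero by (intro power_envelope) auto
    also have "exp (rate * h) * (1 - \<alpha>) = exp (- (rate * max 0 (hbar - h)))"
    proof -
      \<comment> \<open>the two bounds agree because \<open>hbar\<close> was chosen so that \<open>exp (- rate * hbar) = 1 - \<alpha>\<close>\<close>
      have "- (rate * max 0 (hbar - h)) = rate * h + ln (1 - \<alpha>)"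
        using h hbar rh by (simp add: max_def algebra_simps)
      then show ?thesis using assms(2) by (simp add: exp_add)
    qed
    also have "ereal (1 - exp (- (rate * max 0 (hbar - h)))) = liminf (\<lambda>n. ereal (\<integral>\<omega>. ?\<phi> n \<omega> \<partial>?P h n))"
      using limit[of h] h by (intro lim_imp_Liminf[symmetric]) auto
    finally show "limsup (\<lambda>n. ereal (\<integral>\<omega>. \<psi> n \<omega> \<partial>?P h n)) \<le> liminf (\<lambda>n. ereal (\<integral>\<omega>. ?\<phi> n \<omega> \<partial>?P h n))" .
  qed
qed

end
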